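(* Let $\mathbf{D}$ be a 2-category and let $K:\mathbf{D}\to\mathbf{Cat}$ be a 2-functor. Let $r$ be a 0-cell of $\mathbf{D}$, and let $\mathbf{qNat}(\mathbf{D}(r,-),K(-))$ be the category of quasi-natural transformations $\mathbf{D}(r,-)\to K(-)$ and modifications between them. Then there are (quasi-)adjoint functors $$\Psi_r:\mathbf{qNat}(\mathbf{D}(r,-),K(-))\rightleftarrows K(r):\hat\Psi_r ,\qquad \Psi_r\dashv\hat\Psi_r .$$ The unit of this adjunction, $\mathrm{id}\to\hat\Psi_r\circ\Psi_r$, is quasi-natural. The counit of this adjunction, $\Psi_r\circ\hat\Psi_r\to\mathrm{id}$, is the identity.
   Context: For 2-functors $F,F':\mathbf{D}\to\mathbf{E}$ between 2-categories, a quasi-natural transformation $\sigma:F\to F'$ consists of 1-cells $\sigma_d:F(d)\to F'(d)$ for each 0-cell $d$, and 2-cells $\sigma_f:\sigma_{d'}\circ F(f)\Rightarrow F'(f)\circ\sigma_d$ for each 1-cell $f:d\to d'$, such that: $\sigma_{\mathrm{id}_d}=\mathrm{id}$; $\sigma_{g\circ f}$ is the pasting of $\sigma_f$ and $\sigma_g$; and for each 2-cell $\alpha:f\Rightarrow f'$ one has $(F'(\alpha)*\sigma_d)\circ\sigma_f=\sigma_{f'}\circ(\sigma_{d'}*F(\alpha))$. A modification $\Sigma:\sigma\leadsto\sigma'$ is a family of 2-cells $\Sigma_d:\sigma_d\Rightarrow\sigma'_d$ such that for every 2-cell $\alpha:f\Rightarrow f'$, with $f,f':d\to d'$, one has $\sigma'_{f'}\circ(\Sigma_{d'}*F(\alpha))=(F'(\alpha)*\Sigma_d)\circ\sigma_f$.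 No preservation of products is required here. Categories are regarded as 2-categories with only identity 2-cells when speaking of quasi-naturality of a transformation between functors of categories. The functor $\Psi_r$ is evaluation at the identity: $\Psi_r(\sigma)=\sigma_r(\mathrm{id}_r)$ and $\Psi_r(\Sigma)=(\Sigma_r)_{\mathrm{id}_r}$. The functor $\hat\Psi_r$ sends $U\in K(r)$ to $\sigma_U$ with $\sigma_{U,d}(f)=K(f)(U)$ and $\sigma_{U,d}(\alpha)=K(\alpha)_U$ for $f,f':r\to d$ and $\alpha:f\Rightarrow f'$. It sends $t:U\to U'$ in $K(r)$ to the modification $\Sigma_t$ with $\Sigma_{t,d}(f)=K(f)(t)$. *)

theory Defs
  imports "HOL-Library.FuncSet"
begin

section \<open>Categories, functors, natural transformations\<close>

record ('o, 'm) cat =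
  Obj :: "'o set"
  Arr :: "'m set"
  Dom :: "'m \<Rightarrow> 'o"
  Cod :: "'m \<Rightarrow> 'o"
  Ide :: "'o \<Rightarrow> 'm"
  Comp :: "'m \<Rightarrow> 'm \<Rightarrow> 'm"  (infixr "\<cdot>\<index>" 70)

definition Hom :: "('o, 'm) cat \<Rightarrow> 'o \<Rightarrow> 'o \<Rightarrow> 'm set" where
  "Hom C a b = {f \<in> Arr C. Dom C f = a \<and> Cod C f = b}"

locale category =
  fixes C :: "('o, 'm) cat" (structure)
  assumes Dom_Obj: "f \<in> Arr C \<Longrightarrow> Dom C f \<in> Obj C"
    and Cod_Obj: "f \<in> Arr C \<Longrightarrow> Cod C f \<in> Obj C"
    and Ide_Hom: "a \<in> Obj C \<Longrightarrow> Ide C a \<in> Hom C a a"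
    and Comp_Hom: "f \<in> Hom C a b \<Longrightarrow> g \<in> Hom C b c \<Longrightarrow> g \<cdot> f \<in> Hom C a c"
    and Comp_assoc: "f \<in> Hom C a b \<Longrightarrow> g \<in> Hom C b c \<Longrightarrow> h \<in> Hom C c d \<Longrightarrow>
          (h \<cdot> g) \<cdot> f = h \<cdot> (g \<cdot> f)"
    and Comp_Ide_left: "f \<in> Hom C a b \<Longrightarrow> Ide C b \<cdot> f = f"
    and Comp_Ide_right: "f \<in> Hom C a b \<Longrightarrow> f \<cdot> Ide C a = f"

text \<open>
  The maps of a functor and the components of a natural transformation are required to be
  undefined outside their domain, so that HOL equality is the intended equality.
\<close>

record ('o, 'm, 'p, 'n) fctr =
  FO :: "'o \<Rightarrow> 'p"
  FA :: "'m \<Rightarrow> 'n"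

locale is_functor = A: category A + B: category B
  for A :: "('o, 'm) cat" and B :: "('p, 'n) cat" +
  fixes F :: "('o, 'm, 'p, 'n) fctr"
  assumes FO_ext: "FO F \<in> extensional (Obj A)"
    and FA_ext: "FA F \<in> extensional (Arr A)"
    and FO_Obj: "a \<in> Obj A \<Longrightarrow> FO F a \<in> Obj B"
    and FA_Hom: "f \<in> Hom A a b \<Longrightarrow> FA F f \<in> Hom B (FO F a) (FO F b)"
    and FA_Ide: "a \<in> Obj A \<Longrightarrow> FA F (Ide A a) = Ide B (FO F a)"
    and FA_Comp: "f \<in> Hom A a b \<Longrightarrow> g \<in> Hom A b c \<Longrightarrow>
          FA F (g \<cdot>\<^bsub>A\<^esub> f) = FA F g \<cdot>\<^bsub>B\<^esub> FA F f"

definition id_functor :: "('o, 'm) cat \<Rightarrow> ('o, 'm, 'o, 'm) fctr" where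
  "id_functor A = \<lparr>FO = (\<lambda>a\<in>Obj A. a), FA = (\<lambda>f\<in>Arr A. f)\<rparr>"

definition comp_functor ::
  "('o, 'm) cat \<Rightarrow> ('p, 'n, 'q, 'k) fctr \<Rightarrow> ('o, 'm, 'p, 'n) fctr \<Rightarrow> ('o, 'm, 'q, 'k) fctr" where
  "comp_functor A G F =
     \<lparr>FO = compose (Obj A) (FO G) (FO F), FA = compose (Arr A) (FA G) (FA F)\<rparr>"

record ('o, 'm, 'p, 'n) ntr =
  Src :: "('o, 'm, 'p, 'n) fctr"
  Trg :: "('o, 'm, 'p, 'n) fctr"
  Cmp :: "'o \<Rightarrow> 'n"

locale nat_trans = S: is_functor A B "Src \<tau>" + T: is_functor A B "Trg \<tau>"
  for A :: "('o, 'm) cat" and B :: "('p, 'n) cat" and \<tau> :: "('o, 'm, 'p, 'n) ntr" +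
  assumes Cmp_ext: "Cmp \<tau> \<in> extensional (Obj A)"
    and Cmp_Hom: "a \<in> Obj A \<Longrightarrow> Cmp \<tau> a \<in> Hom B (FO (Src \<tau>) a) (FO (Trg \<tau>) a)"
    and naturality: "f \<in> Hom A a b \<Longrightarrow>
          Cmp \<tau> b \<cdot>\<^bsub>B\<^esub> FA (Src \<tau>) f = FA (Trg \<tau>) f \<cdot>\<^bsub>B\<^esub> Cmp \<tau> a"

definition functor_cat ::
  "('o, 'm) cat \<Rightarrow> ('p, 'n) cat \<Rightarrow> (('o, 'm, 'p, 'n) fctr, ('o, 'm, 'p, 'n) ntr) cat" where
  "functor_cat A B =
     \<lparr>Obj = {F. is_functor A B F},
      Arr = {\<tau>. nat_trans A B \<tau>},
      Dom = Src,
      Cod = Trg,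
      Ide = (\<lambda>F. \<lparr>Src = F, Trg = F, Cmp = (\<lambda>a\<in>Obj A. Ide B (FO F a))\<rparr>),
      Comp = (\<lambda>\<tau>' \<tau>. \<lparr>Src = Src \<tau>, Trg = Trg \<tau>', Cmp = (\<lambda>a\<in>Obj A. Cmp \<tau>' a \<cdot>\<^bsub>B\<^esub> Cmp \<tau> a)\<rparr>)\<rparr>"

definition hcomp ::
  "('o, 'm) cat \<Rightarrow> ('q, 'k) cat \<Rightarrow> ('p, 'n, 'q, 'k) ntr \<Rightarrow> ('o, 'm, 'p, 'n) ntr \<Rightarrow>
     ('o, 'm, 'q, 'k) ntr" where
  "hcomp A C \<beta> \<alpha> =
     \<lparr>Src = comp_functor A (Src \<beta>) (Src \<alpha>),
      Trg = comp_functor A (Trg \<beta>) (Trg \<alpha>),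
      Cmp = (\<lambda>a\<in>Obj A. Cmp \<beta> (FO (Trg \<alpha>) a) \<cdot>\<^bsub>C\<^esub> FA (Src \<beta>) (Cmp \<alpha> a))\<rparr>"

locale adjunction = F: is_functor A B F + G: is_functor B A G +
  unit: nat_trans A A \<eta> + counit: nat_trans B B \<epsilon>
  for A :: "('o, 'm) cat" and B :: "('p, 'n) cat"
    and F :: "('o, 'm, 'p, 'n) fctr" and G :: "('p, 'n, 'o, 'm) fctr"
    and \<eta> :: "('o, 'm, 'o, 'm) ntr" and \<epsilon> :: "('p, 'n, 'p, 'n) ntr" +
  assumes Src_unit: "Src \<eta> = id_functor A"
    and Trg_unit: "Trg \<eta> = comp_functor A G F"
    and Src_counit: "Src \<epsilon> = comp_functor B F G"
    and Trg_counit: "Trg \<epsilon> = id_functor B"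
    and triangle_left: "a \<in> Obj A \<Longrightarrow>
          Cmp \<epsilon> (FO F a) \<cdot>\<^bsub>B\<^esub> FA F (Cmp \<eta> a) = Ide B (FO F a)"
    and triangle_right: "b \<in> Obj B \<Longrightarrow>
          FA G (Cmp \<epsilon> b) \<cdot>\<^bsub>A\<^esub> Cmp \<eta> (FO G b) = Ide A (FO G b)"


section \<open>Strict 2-categories and 2-functors\<close>

text \<open>
  A 2-category is given by its hom-categories: the objects and arrows of \<open>Hom2 D a b\<close> are the
  1-cells from \<open>a\<close> to \<open>b\<close> and the 2-cells between them. Different hom-categories may
  share cells, so compositions carry their 0-cells as arguments: for \<open>f\<close> from \<open>a\<close> to \<open>b\<close>
  and \<open>g\<close> from \<open>b\<close> to \<open>c\<close>, the composite of \<open>g\<close> after \<open>f\<close> is \<open>Comp1 D a b c g f\<close>,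
  and \<open>Comp2 D a b c\<close> is horizontal composition of 2-cells.
\<close>

record ('c, 'o, 'm) two_cat =
  Obj0 :: "'c set"
  Hom2 :: "'c \<Rightarrow> 'c \<Rightarrow> ('o, 'm) cat"
  One :: "'c \<Rightarrow> 'o"
  Comp1 :: "'c \<Rightarrow> 'c \<Rightarrow> 'c \<Rightarrow> 'o \<Rightarrow> 'o \<Rightarrow> 'o"
  Comp2 :: "'c \<Rightarrow> 'c \<Rightarrow> 'c \<Rightarrow> 'm \<Rightarrow> 'm \<Rightarrow> 'm"

locale two_category =
  fixes D :: "('c, 'o, 'm) two_cat"
  assumes category_Hom2: "a \<in> Obj0 D \<Longrightarrow> b \<in> Obj0 D \<Longrightarrow> category (Hom2 D a b)"
    and One_Obj: "a \<in> Obj0 D \<Longrightarrow> One D a \<in> Obj (Hom2 D a a)"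
    and Comp1_Obj: "\<lbrakk>a \<in> Obj0 D; b \<in> Obj0 D; c \<in> Obj0 D;
          f \<in> Obj (Hom2 D a b); g \<in> Obj (Hom2 D b c)\<rbrakk> \<Longrightarrow>
          Comp1 D a b c g f \<in> Obj (Hom2 D a c)"
    and Comp2_Hom: "\<lbrakk>a \<in> Obj0 D; b \<in> Obj0 D; c \<in> Obj0 D;
          \<alpha> \<in> Hom (Hom2 D a b) f f'; \<beta> \<in> Hom (Hom2 D b c) g g'\<rbrakk> \<Longrightarrow>
          Comp2 D a b c \<beta> \<alpha> \<in> Hom (Hom2 D a c) (Comp1 D a b c g f) (Comp1 D a b c g' f')"
    and Comp2_Ide: "\<lbrakk>a \<in> Obj0 D; b \<in> Obj0 D; c \<in> Obj0 D;
          f \<in> Obj (Hom2 D a b); g \<in> Obj (Hom2 D b c)\<rbrakk> \<Longrightarrow>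
          Comp2 D a b c (Ide (Hom2 D b c) g) (Ide (Hom2 D a b) f)
            = Ide (Hom2 D a c) (Comp1 D a b c g f)"
    and interchange: "\<lbrakk>a \<in> Obj0 D; b \<in> Obj0 D; c \<in> Obj0 D;
          \<alpha> \<in> Hom (Hom2 D a b) f f'; \<alpha>' \<in> Hom (Hom2 D a b) f' f'';
          \<beta> \<in> Hom (Hom2 D b c) g g'; \<beta>' \<in> Hom (Hom2 D b c) g' g''\<rbrakk> \<Longrightarrow>
          Comp2 D a b c (\<beta>' \<cdot>\<^bsub>Hom2 D b c\<^esub> \<beta>) (\<alpha>' \<cdot>\<^bsub>Hom2 D a b\<^esub> \<alpha>)
            = Comp2 D a b c \<beta>' \<alpha>' \<cdot>\<^bsub>Hom2 D a c\<^esub> Comp2 D a b c \<beta> \<alpha>"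
    and Comp1_One_left: "\<lbrakk>a \<in> Obj0 D; b \<in> Obj0 D; f \<in> Obj (Hom2 D a b)\<rbrakk> \<Longrightarrow>
          Comp1 D a b b (One D b) f = f"
    and Comp1_One_right: "\<lbrakk>a \<in> Obj0 D; b \<in> Obj0 D; f \<in> Obj (Hom2 D a b)\<rbrakk> \<Longrightarrow>
          Comp1 D a a b f (One D a) = f"
    and Comp2_One_left: "\<lbrakk>a \<in> Obj0 D; b \<in> Obj0 D; \<alpha> \<in> Arr (Hom2 D a b)\<rbrakk> \<Longrightarrow>
          Comp2 D a b b (Ide (Hom2 D b b) (One D b)) \<alpha> = \<alpha>"
    and Comp2_One_right: "\<lbrakk>a \<in> Obj0 D; b \<in> Obj0 D; \<alpha> \<in> Arr (Hom2 D a b)\<rbrakk> \<Longrightarrow>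
          Comp2 D a a b \<alpha> (Ide (Hom2 D a a) (One D a)) = \<alpha>"
    and Comp1_assoc: "\<lbrakk>a \<in> Obj0 D; b \<in> Obj0 D; c \<in> Obj0 D; d \<in> Obj0 D;
          f \<in> Obj (Hom2 D a b); g \<in> Obj (Hom2 D b c); h \<in> Obj (Hom2 D c d)\<rbrakk> \<Longrightarrow>
          Comp1 D a b d (Comp1 D b c d h g) f = Comp1 D a c d h (Comp1 D a b c g f)"
    and Comp2_assoc: "\<lbrakk>a \<in> Obj0 D; b \<in> Obj0 D; c \<in> Obj0 D; d \<in> Obj0 D;
          \<alpha> \<in> Arr (Hom2 D a b); \<beta> \<in> Arr (Hom2 D b c); \<gamma> \<in> Arr (Hom2 D c d)\<rbrakk> \<Longrightarrow>
          Comp2 D a b d (Comp2 D b c d \<gamma> \<beta>) \<alpha> = Comp2 D a c d \<gamma> (Comp2 D a b c \<beta> \<alpha>)"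

definition whisker_left ::
  "('c, 'o, 'm) two_cat \<Rightarrow> 'c \<Rightarrow> 'c \<Rightarrow> 'c \<Rightarrow> 'o \<Rightarrow> 'm \<Rightarrow> 'm" where
  "whisker_left D a b c g \<alpha> = Comp2 D a b c (Ide (Hom2 D b c) g) \<alpha>"

definition whisker_right ::
  "('c, 'o, 'm) two_cat \<Rightarrow> 'c \<Rightarrow> 'c \<Rightarrow> 'c \<Rightarrow> 'm \<Rightarrow> 'o \<Rightarrow> 'm" where
  "whisker_right D a b c \<beta> f = Comp2 D a b c \<beta> (Ide (Hom2 D a b) f)"

record ('c, 'o, 'm, 'd, 'p, 'n) two_fctr =
  F0 :: "'c \<Rightarrow> 'd"
  F_hom :: "'c \<Rightarrow> 'c \<Rightarrow> ('o, 'm, 'p, 'n) fctr"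

abbreviation F1 :: "('c, 'o, 'm, 'd, 'p, 'n) two_fctr \<Rightarrow> 'c \<Rightarrow> 'c \<Rightarrow> 'o \<Rightarrow> 'p" where
  "F1 F a b \<equiv> FO (F_hom F a b)"

abbreviation F2 :: "('c, 'o, 'm, 'd, 'p, 'n) two_fctr \<Rightarrow> 'c \<Rightarrow> 'c \<Rightarrow> 'm \<Rightarrow> 'n" where
  "F2 F a b \<equiv> FA (F_hom F a b)"

locale two_functor = D: two_category D + E: two_category E
  for D :: "('c, 'o, 'm) two_cat" and E :: "('d, 'p, 'n) two_cat" +
  fixes F :: "('c, 'o, 'm, 'd, 'p, 'n) two_fctr"
  assumes F0_Obj0: "a \<in> Obj0 D \<Longrightarrow> F0 F a \<in> Obj0 E"
    and F_hom_functor: "a \<in> Obj0 D \<Longrightarrow> b \<in> Obj0 D \<Longrightarrow>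
          is_functor (Hom2 D a b) (Hom2 E (F0 F a) (F0 F b)) (F_hom F a b)"
    and F1_One: "a \<in> Obj0 D \<Longrightarrow> F1 F a a (One D a) = One E (F0 F a)"
    and F1_Comp1: "\<lbrakk>a \<in> Obj0 D; b \<in> Obj0 D; c \<in> Obj0 D;
          f \<in> Obj (Hom2 D a b); g \<in> Obj (Hom2 D b c)\<rbrakk> \<Longrightarrow>
          F1 F a c (Comp1 D a b c g f)
            = Comp1 E (F0 F a) (F0 F b) (F0 F c) (F1 F b c g) (F1 F a b f)"
    and F2_Comp2: "\<lbrakk>a \<in> Obj0 D; b \<in> Obj0 D; c \<in> Obj0 D;
          \<alpha> \<in> Arr (Hom2 D a b); \<beta> \<in> Arr (Hom2 D b c)\<rbrakk> \<Longrightarrow>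
          F2 F a c (Comp2 D a b c \<beta> \<alpha>)
            = Comp2 E (F0 F a) (F0 F b) (F0 F c) (F2 F b c \<beta>) (F2 F a b \<alpha>)"

text \<open>
  The 2-category of categories whose objects and arrows are taken from the types \<open>'o\<close> and
  \<open>'m\<close>. A 2-category whose 1-cells and 2-cells have these types has all its hom-categories
  in \<open>Cat\<close> (its 0-cells can be of any type).
\<close>

definition Cat ::
  "(('o, 'm) cat, ('o, 'm, 'o, 'm) fctr, ('o, 'm, 'o, 'm) ntr) two_cat" where
  "Cat =
     \<lparr>Obj0 = {A. category A},
      Hom2 = functor_cat,
      One = id_functor,
      Comp1 = (\<lambda>A B C. comp_functor A),
      Comp2 = (\<lambda>A B C. hcomp A C)\<rparr>"

definition representable ::
  "('c, 'o, 'm) two_cat \<Rightarrow> 'c \<Rightarrow>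
     ('c, 'o, 'm, ('o, 'm) cat, ('o, 'm, 'o, 'm) fctr, ('o, 'm, 'o, 'm) ntr) two_fctr" where
  "representable D r =
     (let post = (\<lambda>a b f.
        \<lparr>FO = (\<lambda>g\<in>Obj (Hom2 D r a). Comp1 D r a b f g),
         FA = (\<lambda>\<gamma>\<in>Arr (Hom2 D r a). whisker_left D r a b f \<gamma>)\<rparr>)
      in \<lparr>F0 = Hom2 D r,
          F_hom = (\<lambda>a b.
            \<lparr>FO = (\<lambda>f\<in>Obj (Hom2 D a b). post a b f),
             FA = (\<lambda>\<alpha>\<in>Arr (Hom2 D a b).
               \<lparr>Src = post a b (Dom (Hom2 D a b) \<alpha>),
                Trg = post a b (Cod (Hom2 D a b) \<alpha>),
                Cmp = (\<lambda>g\<in>Obj (Hom2 D r a). whisker_right D r a b \<alpha> g)\<rparr>)\<rparr>)\<rparr>)"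


section \<open>Quasi-natural transformations and modifications\<close>

text \<open>
  \<open>Q2 \<sigma> (a, b, f)\<close> is the 2-cell of \<open>\<sigma>\<close> at the 1-cell \<open>f\<close> from \<open>a\<close> to \<open>b\<close>; the 0-cells are part
  of the index because hom-categories may share 1-cells.
\<close>

definition cells1 :: "('c, 'o, 'm) two_cat \<Rightarrow> ('c \<times> 'c \<times> 'o) set" where
  "cells1 D = {(a, b, f). a \<in> Obj0 D \<and> b \<in> Obj0 D \<and> f \<in> Obj (Hom2 D a b)}"

record ('c, 'o, 'p, 'n) qntr =
  Q1 :: "'c \<Rightarrow> 'p"
  Q2 :: "'c \<times> 'c \<times> 'o \<Rightarrow> 'n"

locale quasi_natural = F: two_functor D E F + F': two_functor D E F'
  for D :: "('c, 'o, 'm) two_cat" and E :: "('d, 'p, 'n) two_cat"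
    and F F' :: "('c, 'o, 'm, 'd, 'p, 'n) two_fctr" +
  fixes \<sigma> :: "('c, 'o, 'p, 'n) qntr"
  assumes Q1_ext: "Q1 \<sigma> \<in> extensional (Obj0 D)"
    and Q2_ext: "Q2 \<sigma> \<in> extensional (cells1 D)"
    and Q1_Obj: "a \<in> Obj0 D \<Longrightarrow> Q1 \<sigma> a \<in> Obj (Hom2 E (F0 F a) (F0 F' a))"
    and Q2_Hom: "\<lbrakk>a \<in> Obj0 D; b \<in> Obj0 D; f \<in> Obj (Hom2 D a b)\<rbrakk> \<Longrightarrow>
          Q2 \<sigma> (a, b, f) \<in> Hom (Hom2 E (F0 F a) (F0 F' b))
            (Comp1 E (F0 F a) (F0 F b) (F0 F' b) (Q1 \<sigma> b) (F1 F a b f))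
            (Comp1 E (F0 F a) (F0 F' a) (F0 F' b) (F1 F' a b f) (Q1 \<sigma> a))"
    and Q2_One: "a \<in> Obj0 D \<Longrightarrow>
          Q2 \<sigma> (a, a, One D a) = Ide (Hom2 E (F0 F a) (F0 F' a)) (Q1 \<sigma> a)"
    and Q2_Comp1: "\<lbrakk>a \<in> Obj0 D; b \<in> Obj0 D; c \<in> Obj0 D;
          f \<in> Obj (Hom2 D a b); g \<in> Obj (Hom2 D b c)\<rbrakk> \<Longrightarrow>
          Q2 \<sigma> (a, c, Comp1 D a b c g f)
            = whisker_left E (F0 F a) (F0 F' b) (F0 F' c) (F1 F' b c g) (Q2 \<sigma> (a, b, f))
              \<cdot>\<^bsub>Hom2 E (F0 F a) (F0 F' c)\<^esub>
              whisker_right E (F0 F a) (F0 F b) (F0 F' c) (Q2 \<sigma> (b, c, g)) (F1 F a b f)"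
    and Q2_natural: "\<lbrakk>a \<in> Obj0 D; b \<in> Obj0 D; \<alpha> \<in> Hom (Hom2 D a b) f f'\<rbrakk> \<Longrightarrow>
          whisker_right E (F0 F a) (F0 F' a) (F0 F' b) (F2 F' a b \<alpha>) (Q1 \<sigma> a)
            \<cdot>\<^bsub>Hom2 E (F0 F a) (F0 F' b)\<^esub> Q2 \<sigma> (a, b, f)
          = Q2 \<sigma> (a, b, f')
            \<cdot>\<^bsub>Hom2 E (F0 F a) (F0 F' b)\<^esub>
            whisker_left E (F0 F a) (F0 F b) (F0 F' b) (Q1 \<sigma> b) (F2 F a b \<alpha>)"

record ('c, 'o, 'p, 'n) modif =
  MSrc :: "('c, 'o, 'p, 'n) qntr"
  MTrg :: "('c, 'o, 'p, 'n) qntr"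
  MCmp :: "'c \<Rightarrow> 'n"

text \<open>
  In the last axiom the star between a 2-cell of \<open>\<Sigma>\<close> and the image of \<open>\<alpha>\<close> is the full
  horizontal composition of 2-cells, not a whiskering.
\<close>

locale modification =
  S: quasi_natural D E F F' "MSrc \<Sigma>" + T: quasi_natural D E F F' "MTrg \<Sigma>"
  for D :: "('c, 'o, 'm) two_cat" and E :: "('d, 'p, 'n) two_cat"
    and F F' :: "('c, 'o, 'm, 'd, 'p, 'n) two_fctr"
    and \<Sigma> :: "('c, 'o, 'p, 'n) modif" +
  assumes MCmp_ext: "MCmp \<Sigma> \<in> extensional (Obj0 D)"
    and MCmp_Hom: "a \<in> Obj0 D \<Longrightarrow>
          MCmp \<Sigma> a \<in> Hom (Hom2 E (F0 F a) (F0 F' a)) (Q1 (MSrc \<Sigma>) a) (Q1 (MTrg \<Sigma>) a)"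
    and MCmp_natural: "\<lbrakk>a \<in> Obj0 D; b \<in> Obj0 D; \<alpha> \<in> Hom (Hom2 D a b) f f'\<rbrakk> \<Longrightarrow>
          Q2 (MTrg \<Sigma>) (a, b, f')
            \<cdot>\<^bsub>Hom2 E (F0 F a) (F0 F' b)\<^esub>
            Comp2 E (F0 F a) (F0 F b) (F0 F' b) (MCmp \<Sigma> b) (F2 F a b \<alpha>)
          = Comp2 E (F0 F a) (F0 F' a) (F0 F' b) (F2 F' a b \<alpha>) (MCmp \<Sigma> a)
            \<cdot>\<^bsub>Hom2 E (F0 F a) (F0 F' b)\<^esub> Q2 (MSrc \<Sigma>) (a, b, f)"

definition qNat ::
  "('c, 'o, 'm) two_cat \<Rightarrow> ('d, 'p, 'n) two_cat \<Rightarrow>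
     ('c, 'o, 'm, 'd, 'p, 'n) two_fctr \<Rightarrow> ('c, 'o, 'm, 'd, 'p, 'n) two_fctr \<Rightarrow>
     (('c, 'o, 'p, 'n) qntr, ('c, 'o, 'p, 'n) modif) cat" where
  "qNat D E F F' =
     \<lparr>Obj = {\<sigma>. quasi_natural D E F F' \<sigma>},
      Arr = {\<Sigma>. modification D E F F' \<Sigma>},
      Dom = MSrc,
      Cod = MTrg,
      Ide = (\<lambda>\<sigma>. \<lparr>MSrc = \<sigma>, MTrg = \<sigma>,
              MCmp = (\<lambda>a\<in>Obj0 D. Ide (Hom2 E (F0 F a) (F0 F' a)) (Q1 \<sigma> a))\<rparr>),
      Comp = (\<lambda>\<Sigma>' \<Sigma>. \<lparr>MSrc = MSrc \<Sigma>, MTrg = MTrg \<Sigma>',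
              MCmp = (\<lambda>a\<in>Obj0 D. MCmp \<Sigma>' a \<cdot>\<^bsub>Hom2 E (F0 F a) (F0 F' a)\<^esub> MCmp \<Sigma> a)\<rparr>)\<rparr>"


section \<open>Categories as 2-categories with only identity 2-cells\<close>

text \<open>The identity 2-cell of an arrow is represented by the arrow itself.\<close>

definition disc :: "('o, 'm) cat \<Rightarrow> ('o, 'm, 'm) two_cat" where
  "disc A =
     \<lparr>Obj0 = Obj A,
      Hom2 = (\<lambda>a b. \<lparr>Obj = Hom A a b, Arr = Hom A a b, Dom = (\<lambda>f. f), Cod = (\<lambda>f. f),
                     Ide = (\<lambda>f. f), Comp = (\<lambda>g f. f)\<rparr>),
      One = Ide A,
      Comp1 = (\<lambda>a b c. Comp A),
      Comp2 = (\<lambda>a b c. Comp A)\<rparr>"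

definition disc_functor ::
  "('o, 'm) cat \<Rightarrow> ('o, 'm, 'p, 'n) fctr \<Rightarrow> ('o, 'm, 'm, 'p, 'n, 'n) two_fctr" where
  "disc_functor A F =
     \<lparr>F0 = FO F,
      F_hom = (\<lambda>a b. \<lparr>FO = restrict (FA F) (Hom A a b), FA = restrict (FA F) (Hom A a b)\<rparr>)\<rparr>"

text \<open>
  A transformation between functors of categories, viewed between locally discrete
  2-categories: the 2-cell at \<open>f\<close> from \<open>a\<close> to \<open>b\<close> can only be the identity of its source,
  the composite of the image of \<open>f\<close> with the component at \<open>b\<close>.
\<close>

definition disc_trans ::
  "('o, 'm) cat \<Rightarrow> ('p, 'n) cat \<Rightarrow> ('o, 'm, 'p, 'n) ntr \<Rightarrow> ('o, 'm, 'n, 'n) qntr" where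
  "disc_trans A B \<tau> =
     \<lparr>Q1 = Cmp \<tau>,
      Q2 = (\<lambda>(a, b, f)\<in>cells1 (disc A). Cmp \<tau> b \<cdot>\<^bsub>B\<^esub> FA (Src \<tau>) f)\<rparr>"

definition quasi_natural_trans :: "('o, 'm) cat \<Rightarrow> ('p, 'n) cat \<Rightarrow> ('o, 'm, 'p, 'n) ntr \<Rightarrow> bool" where
  "quasi_natural_trans A B \<tau> \<longleftrightarrow>
     quasi_natural (disc A) (disc B) (disc_functor A (Src \<tau>)) (disc_functor A (Trg \<tau>))
       (disc_trans A B \<tau>)"


section \<open>The functors \<open>\<Psi>\<^sub>r\<close> and \<open>\<Psi>hat\<^sub>r\<close>\<close>

definition \<Psi> ::
  "('c, 'o, 'm) two_cat \<Rightarrow>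
     ('c, 'o, 'm, ('o, 'm) cat, ('o, 'm, 'o, 'm) fctr, ('o, 'm, 'o, 'm) ntr) two_fctr \<Rightarrow> 'c \<Rightarrow>
     (('c, 'o, ('o, 'm, 'o, 'm) fctr, ('o, 'm, 'o, 'm) ntr) qntr,
      ('c, 'o, ('o, 'm, 'o, 'm) fctr, ('o, 'm, 'o, 'm) ntr) modif, 'o, 'm) fctr" where
  "\<Psi> D K r =
     \<lparr>FO = (\<lambda>\<sigma>\<in>Obj (qNat D Cat (representable D r) K). FO (Q1 \<sigma> r) (One D r)),
      FA = (\<lambda>\<Sigma>\<in>Arr (qNat D Cat (representable D r) K). Cmp (MCmp \<Sigma> r) (One D r))\<rparr>"

text \<open>
  The transformation \<open>\<Psi>hat_obj D K r U\<close> is strict: its 2-cells are identities.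
\<close>

definition \<Psi>hat_obj ::
  "('c, 'o, 'm) two_cat \<Rightarrow>
     ('c, 'o, 'm, ('o, 'm) cat, ('o, 'm, 'o, 'm) fctr, ('o, 'm, 'o, 'm) ntr) two_fctr \<Rightarrow> 'c \<Rightarrow>
     'o \<Rightarrow> ('c, 'o, ('o, 'm, 'o, 'm) fctr, ('o, 'm, 'o, 'm) ntr) qntr" where
  "\<Psi>hat_obj D K r U =
     (let \<sigma> = (\<lambda>d. \<lparr>FO = (\<lambda>f\<in>Obj (Hom2 D r d). FO (F1 K r d f) U),
                    FA = (\<lambda>\<alpha>\<in>Arr (Hom2 D r d). Cmp (F2 K r d \<alpha>) U)\<rparr>)
      in \<lparr>Q1 = (\<lambda>d\<in>Obj0 D. \<sigma> d),
          Q2 = (\<lambda>(d, d', f)\<in>cells1 D.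
            Ide (Hom2 Cat (Hom2 D r d) (F0 K d'))
              (Comp1 Cat (Hom2 D r d) (Hom2 D r d') (F0 K d')
                 (\<sigma> d') (F1 (representable D r) d d' f)))\<rparr>)"

definition \<Psi>hat_arr ::
  "('c, 'o, 'm) two_cat \<Rightarrow>
     ('c, 'o, 'm, ('o, 'm) cat, ('o, 'm, 'o, 'm) fctr, ('o, 'm, 'o, 'm) ntr) two_fctr \<Rightarrow> 'c \<Rightarrow>
     'm \<Rightarrow> ('c, 'o, ('o, 'm, 'o, 'm) fctr, ('o, 'm, 'o, 'm) ntr) modif" where
  "\<Psi>hat_arr D K r t =
     (let \<sigma> = \<Psi>hat_obj D K r (Dom (F0 K r) t); \<sigma>' = \<Psi>hat_obj D K r (Cod (F0 K r) t)
      in \<lparr>MSrc = \<sigma>, MTrg = \<sigma>',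
          MCmp = (\<lambda>d\<in>Obj0 D. \<lparr>Src = Q1 \<sigma> d, Trg = Q1 \<sigma>' d,
                    Cmp = (\<lambda>f\<in>Obj (Hom2 D r d). FA (F1 K r d f) t)\<rparr>)\<rparr>)"

definition \<Psi>hat ::
  "('c, 'o, 'm) two_cat \<Rightarrow>
     ('c, 'o, 'm, ('o, 'm) cat, ('o, 'm, 'o, 'm) fctr, ('o, 'm, 'o, 'm) ntr) two_fctr \<Rightarrow> 'c \<Rightarrow>
     ('o, 'm, ('c, 'o, ('o, 'm, 'o, 'm) fctr, ('o, 'm, 'o, 'm) ntr) qntr,
      ('c, 'o, ('o, 'm, 'o, 'm) fctr, ('o, 'm, 'o, 'm) ntr) modif) fctr" where
  "\<Psi>hat D K r =
     \<lparr>FO = restrict (\<Psi>hat_obj D K r) (Obj (F0 K r)), FA = restrict (\<Psi>hat_arr D K r) (Arr (F0 K r))\<rparr>"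

end

theory Submission
  imports Defs
begin

text \<open>
  The unit at \<open>\<sigma>\<close> is the modification whose component at \<open>d\<close> and \<open>f\<close> from \<open>r\<close> to \<open>d\<close> is
  \<open>(\<sigma>\<^sub>f)\<close> evaluated at the identity of \<open>r\<close>, an arrow from \<open>\<sigma>\<^sub>d(f)\<close> to \<open>K(f)(\<sigma>\<^sub>r(id))\<close>.
  It is natural in \<open>f\<close> by the compatibility of \<open>\<sigma>\<close> with 2-cells, it is a modification by the pasting
  axiom for \<open>\<sigma>\<close> at composites, and it is natural in \<open>\<sigma>\<close> by the modification axiom at identity
  2-cells. It is the identity on the image of \<open>\<Psi>hat\<close>, whose 2-cells are identities, and \<open>\<Psi>\<close> sends it
  to an identity because \<open>\<sigma>\<close> is normalized at identity 1-cells; these are the triangle identities.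
  Quasi-naturality between locally discrete 2-categories is ordinary naturality.
\<close>

section \<open>The 2-category of categories\<close>

text \<open>If every \<sigma>_f were an identity, the arrow from \<sigma>_d(f) to
  K(f)(\<sigma>_r(id)) would be an equality and evaluation at the identity would be the strict
  2-categorical Yoneda correspondence. Here \<sigma>_f need not be invertible, so only a comparison
  arrow is left. Its direction, fixed by the convention that \<sigma>_f starts at \<sigma>_d' after
  F(f), is what makes evaluation the left adjoint. The other composite stays an equality of functors
  because \<open>K\<close> preserves identity 1-cells strictly.

  The obstacle is that cells of \<open>Cat\<close> are records built from functions, and sources and
  targets must agree as HOL values before a composite makes sense. Equations between modifications
  are therefore reduced twice: by \<open>modification_eqI\<close> to one natural transformation for
  each 0-cell, and by \<open>nat_trans_eqI\<close> to one arrow of K(d) for each 1-cell from r to d.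
  The axioms for \<sigma>, \<Sigma> and \<open>K\<close> are brought into the same componentwise
  form, so that the decisive computations take place inside ordinary categories K(d).\<close>

lemma in_Hom_iff: "f \<in> Hom C a b \<longleftrightarrow> f \<in> Arr C \<and> Dom C f = a \<and> Cod C f = b"
  by (simp add: Hom_def)

lemma Arr_in_Hom: "f \<in> Arr C \<Longrightarrow> f \<in> Hom C (Dom C f) (Cod C f)"
  by (simp add: Hom_def)

lemma fctr_eqI:
  fixes F G :: "('o, 'm, 'p, 'n) fctr"
  shows "FO F = FO G \<Longrightarrow> FA F = FA G \<Longrightarrow> F = G"
  by (cases F, cases G) simp

lemma ntr_eqI:
  fixes \<sigma> \<tau> :: "('o, 'm, 'p, 'n) ntr"
  shows "Src \<sigma> = Src \<tau> \<Longrightarrow> Trg \<sigma> = Trg \<tau> \<Longrightarrow> Cmp \<sigma> = Cmp \<tau> \<Longrightarrow> \<sigma> = \<tau>"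
  by (cases \<sigma>, cases \<tau>) simp

lemma is_functor_eqI:
  assumes "is_functor A B F" "is_functor A' B' G" "Obj A = Obj A'" "Arr A = Arr A'"
    and "\<And>a. a \<in> Obj A \<Longrightarrow> FO F a = FO G a" "\<And>f. f \<in> Arr A \<Longrightarrow> FA F f = FA G f"
  shows "F = G"
proof (rule fctr_eqI)
  show "FO F = FO G"
    using assms is_functor.FO_ext[OF assms(1)] is_functor.FO_ext[OF assms(2)]
    by (metis extensionalityI)
  show "FA F = FA G"
    using assms is_functor.FA_ext[OF assms(1)] is_functor.FA_ext[OF assms(2)]
    by (metis extensionalityI)
qed

lemma nat_trans_eqI:
  assumes "nat_trans A B \<sigma>" "nat_trans A B \<tau>" "Src \<sigma> = Src \<tau>" "Trg \<sigma> = Trg \<tau>"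
    and "\<And>a. a \<in> Obj A \<Longrightarrow> Cmp \<sigma> a = Cmp \<tau> a"
  shows "\<sigma> = \<tau>"
proof (rule ntr_eqI)
  show "Cmp \<sigma> = Cmp \<tau>"
    using assms nat_trans.Cmp_ext[OF assms(1)] nat_trans.Cmp_ext[OF assms(2)]
    by (metis extensionalityI)
qed (use assms in auto)

context is_functor
begin

lemma FA_Arr:
  assumes "f \<in> Arr A"
  shows "FA F f \<in> Arr B" "Dom B (FA F f) = FO F (Dom A f)" "Cod B (FA F f) = FO F (Cod A f)"
  using FA_Hom[OF Arr_in_Hom[OF assms]] by (auto simp: in_Hom_iff)

end

lemma id_functor_simps [simp]:
  "a \<in> Obj A \<Longrightarrow> FO (id_functor A) a = a"
  "f \<in> Arr A \<Longrightarrow> FA (id_functor A) f = f"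
  by (simp_all add: id_functor_def)

lemma comp_functor_simps [simp]:
  "a \<in> Obj A \<Longrightarrow> FO (comp_functor A G F) a = FO G (FO F a)"
  "f \<in> Arr A \<Longrightarrow> FA (comp_functor A G F) f = FA G (FA F f)"
  by (simp_all add: comp_functor_def compose_def)

lemma is_functor_id: "category A \<Longrightarrow> is_functor A A (id_functor A)"
  unfolding is_functor_def is_functor_axioms_def category_def id_functor_def
  by (simp add: in_Hom_iff)

lemma is_functor_comp:
  assumes "is_functor A B F" "is_functor B C G"
  shows "is_functor A C (comp_functor A G F)"
proof -
  interpret F: is_functor A B F by fact
  interpret G: is_functor B C G by fact
  show ?thesis
  proof
    fix f a b assume f: "f \<in> Hom A a b"
    then have "a \<in> Obj A" "b \<in> Obj A" "f \<in> Arr A"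
      using F.A.Dom_Obj F.A.Cod_Obj by (auto simp: in_Hom_iff)
    then show "FA (comp_functor A G F) f \<in> Hom C (FO (comp_functor A G F) a) (FO (comp_functor A G
        F) b)"
      using G.FA_Hom F.FA_Hom f by simp
  next
    fix f g a b c assume fg: "f \<in> Hom A a b" "g \<in> Hom A b c"
    then have "g \<cdot>\<^bsub>A\<^esub> f \<in> Hom A a c" by (rule F.A.Comp_Hom)
    then have "g \<cdot>\<^bsub>A\<^esub> f \<in> Arr A" "f \<in> Arr A" "g \<in> Arr A" using fg by (auto simp: in_Hom_iff)
    then show "FA (comp_functor A G F) (g \<cdot>\<^bsub>A\<^esub> f)
        = FA (comp_functor A G F) g \<cdot>\<^bsub>C\<^esub> FA (comp_functor A G F) f"
      using F.FA_Comp[OF fg] G.FA_Comp[OF F.FA_Hom[OF fg(1)] F.FA_Hom[OF fg(2)]] by simp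
  next
    fix a assume a: "a \<in> Obj A"
    then have "Ide A a \<in> Arr A" using F.A.Ide_Hom by (auto simp: in_Hom_iff)
    then show "FA (comp_functor A G F) (Ide A a) = Ide C (FO (comp_functor A G F) a)"
      using a by (simp add: F.FA_Ide G.FA_Ide F.FO_Obj)
  qed (auto simp: comp_functor_def F.FO_Obj G.FO_Obj compose_def)
qed

text \<open>Values agree on \<open>A\<close> because \<open>F\<close> lands in the objects and
  arrows of \<open>B\<close>, where the restricted composite of \<open>G\<close> and
  \<open>H\<close> takes its proper values; outside \<open>A\<close> both sides are
  undefined.\<close>

lemma comp_functor_assoc:
  assumes "is_functor A B F"
  shows "comp_functor A (comp_functor B H G) F = comp_functor A H (comp_functor A G F)"
proof -
  interpret is_functor A B F by fact
  show ?thesis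
    by (rule fctr_eqI) (auto simp: comp_functor_def compose_def fun_eq_iff FO_Obj FA_Arr)
qed

lemma comp_functor_id:
  assumes "is_functor A B F"
  shows "comp_functor A (id_functor B) F = F" "comp_functor A F (id_functor A) = F"
proof -
  interpret F: is_functor A B F by fact
  show "comp_functor A (id_functor B) F = F"
    by (rule is_functor_eqI[OF is_functor_comp[OF assms is_functor_id] assms])
      (auto simp: F.FO_Obj F.FA_Arr F.B.category_axioms)
  show "comp_functor A F (id_functor A) = F"
    by (rule is_functor_eqI[OF is_functor_comp[OF is_functor_id assms] assms])
      (auto simp: F.A.category_axioms)
qed

section \<open>Functor categories and vertical composition\<close>

lemma functor_cat_simps:
  "Obj (functor_cat A B) = {F. is_functor A B F}"
  "Arr (functor_cat A B) = {\<tau>. nat_trans A B \<tau>}"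
  "Dom (functor_cat A B) = Src"
  "Cod (functor_cat A B) = Trg"
  "Ide (functor_cat A B) F = \<lparr>Src = F, Trg = F, Cmp = (\<lambda>a\<in>Obj A. Ide B (FO F a))\<rparr>"
  "\<tau> \<cdot>\<^bsub>functor_cat A B\<^esub> \<sigma> = \<lparr>Src = Src \<sigma>, Trg = Trg \<tau>, Cmp = (\<lambda>a\<in>Obj A. Cmp \<tau> a \<cdot>\<^bsub>B\<^esub> Cmp \<sigma> a)\<rparr>"
  by (simp_all add: functor_cat_def)

lemma in_Hom_functor_cat:
  "\<tau> \<in> Hom (functor_cat A B) F G \<longleftrightarrow> nat_trans A B \<tau> \<and> Src \<tau> = F \<and> Trg \<tau> = G"
  by (simp add: in_Hom_iff functor_cat_simps)

lemma nat_trans_Ide: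
  assumes "is_functor A B F"
  shows "nat_trans A B (Ide (functor_cat A B) F)"
proof -
  interpret F: is_functor A B F by fact
  show ?thesis
    unfolding functor_cat_simps
  proof (intro nat_trans.intro, simp_all add: assms, unfold_locales)
    fix f a b assume f: "f \<in> Hom A a b"
    then have "a \<in> Obj A" "b \<in> Obj A"
      using F.A.Dom_Obj F.A.Cod_Obj by (auto simp: in_Hom_iff)
    then show "Cmp \<lparr>Src = F, Trg = F, Cmp = (\<lambda>a\<in>Obj A. Ide B (FO F a))\<rparr> b \<cdot>\<^bsub>B\<^esub>
        FA (Src \<lparr>Src = F, Trg = F, Cmp = (\<lambda>a\<in>Obj A. Ide B (FO F a))\<rparr>) f =
        FA (Trg \<lparr>Src = F, Trg = F, Cmp = (\<lambda>a\<in>Obj A. Ide B (FO F a))\<rparr>) f \<cdot>\<^bsub>B\<^esub>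
        Cmp \<lparr>Src = F, Trg = F, Cmp = (\<lambda>a\<in>Obj A. Ide B (FO F a))\<rparr> a"
      using F.B.Comp_Ide_left[OF F.FA_Hom[OF f]] F.B.Comp_Ide_right[OF F.FA_Hom[OF f]] by simp
  qed (auto simp: F.B.Ide_Hom F.FO_Obj)
qed

lemma nat_trans_Comp:
  assumes "nat_trans A B \<sigma>" "nat_trans A B \<tau>" "Trg \<sigma> = Src \<tau>"
  shows "nat_trans A B (\<tau> \<cdot>\<^bsub>functor_cat A B\<^esub> \<sigma>)"
proof -
  interpret s: nat_trans A B \<sigma> by fact
  interpret t: nat_trans A B \<tau> by fact
  have nat: "(Cmp \<tau> b \<cdot>\<^bsub>B\<^esub> Cmp \<sigma> b) \<cdot>\<^bsub>B\<^esub> FA (Src \<sigma>) f = FA (Trg \<tau>) f \<cdot>\<^bsub>B\<^esub> (Cmp \<tau> a \<cdot>\<^bsub>B\<^esub> Cmp \<sigma> a)"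
    if f: "f \<in> Hom A a b" for f a b
  proof -
    have ab: "a \<in> Obj A" "b \<in> Obj A"
      using f s.S.A.Dom_Obj s.S.A.Cod_Obj by (auto simp: in_Hom_iff)
    note sa = s.Cmp_Hom[OF ab(1)] and sb = s.Cmp_Hom[OF ab(2)]
      and ta = t.Cmp_Hom[OF ab(1)] and tb = t.Cmp_Hom[OF ab(2)]
    have "(Cmp \<tau> b \<cdot>\<^bsub>B\<^esub> Cmp \<sigma> b) \<cdot>\<^bsub>B\<^esub> FA (Src \<sigma>) f = Cmp \<tau> b \<cdot>\<^bsub>B\<^esub> (Cmp \<sigma> b \<cdot>\<^bsub>B\<^esub> FA (Src \<sigma>) f)"
      using s.S.B.Comp_assoc[OF s.S.FA_Hom[OF f] sb] tb assms(3) by simp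
    also have "\<dots> = Cmp \<tau> b \<cdot>\<^bsub>B\<^esub> (FA (Trg \<sigma>) f \<cdot>\<^bsub>B\<^esub> Cmp \<sigma> a)"
      by (simp add: s.naturality[OF f])
    also have "\<dots> = (Cmp \<tau> b \<cdot>\<^bsub>B\<^esub> FA (Trg \<sigma>) f) \<cdot>\<^bsub>B\<^esub> Cmp \<sigma> a"
      using s.S.B.Comp_assoc[OF sa s.T.FA_Hom[OF f]] tb assms(3) by simp
    also have "\<dots> = (FA (Trg \<tau>) f \<cdot>\<^bsub>B\<^esub> Cmp \<tau> a) \<cdot>\<^bsub>B\<^esub> Cmp \<sigma> a"
      by (simp add: t.naturality[OF f] assms(3))
    also have "\<dots> = FA (Trg \<tau>) f \<cdot>\<^bsub>B\<^esub> (Cmp \<tau> a \<cdot>\<^bsub>B\<^esub> Cmp \<sigma> a)"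
      using s.S.B.Comp_assoc[OF sa] ta t.T.FA_Hom[OF f] assms(3) by simp
    finally show ?thesis .
  qed
  show ?thesis
    unfolding functor_cat_simps
  proof (intro nat_trans.intro, goal_cases)
    case 3 show ?case
      unfolding nat_trans_axioms_def
    proof (intro conjI allI impI, goal_cases)
      case (2 a) then show ?case using s.S.B.Comp_Hom[OF s.Cmp_Hom] t.Cmp_Hom assms(3) by simp
    next
      case (3 f a b)
      have "a \<in> Obj A" "b \<in> Obj A"
        using 3 s.S.A.Dom_Obj s.S.A.Cod_Obj by (auto simp: in_Hom_iff)
      with nat[OF 3] show ?case by simp
    qed auto
  qed (simp_all add: s.S.is_functor_axioms t.T.is_functor_axioms)
qed

lemma category_functor_cat:
  assumes "category B"
  shows "category (functor_cat A B)"
proof -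
  interpret B: category B by fact
  show ?thesis
  proof (unfold_locales, goal_cases)
    case (1 f) then show ?case by (simp add: functor_cat_simps nat_trans_def)
  next
    case (2 f) then show ?case by (simp add: functor_cat_simps nat_trans_def)
  next
    case (3 a) then show ?case
      using nat_trans_Ide[of A B a] by (simp add: in_Hom_functor_cat) (simp add: functor_cat_simps)
  next
    case (4 f a b g c) then show ?case
      using nat_trans_Comp[of A B f g] by (simp add: in_Hom_functor_cat) (simp add:
          functor_cat_simps)
  next
    case (5 f a b g c h)
    then have *: "nat_trans A B f" "nat_trans A B g" "nat_trans A B h" "Trg f = Src g" "Trg g =
        Src h"
      by (auto simp: in_Hom_functor_cat)
    show ?case
      unfolding functor_cat_simps
      using * nat_trans.Cmp_Hom[OF *(1)] nat_trans.Cmp_Hom[OF *(2)] nat_trans.Cmp_Hom[OF *(3)]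
      by (auto simp: fun_eq_iff restrict_def intro!: B.Comp_assoc)
  next
    case (6 f a b)
    then have *: "nat_trans A B f" "Trg f = b" by (auto simp: in_Hom_functor_cat)
    have "Cmp f = (\<lambda>x\<in>Obj A. Ide B (FO b x) \<cdot>\<^bsub>B\<^esub> Cmp f x)"
      by (rule extensionalityI[OF nat_trans.Cmp_ext[OF *(1)]])
        (use * nat_trans.Cmp_Hom[OF *(1)] in \<open>auto intro!: B.Comp_Ide_left[symmetric]\<close>)
    from this[symmetric] *(2) show ?case
      by (intro ntr_eqI) (simp_all add: functor_cat_simps cong: restrict_cong)
  next
    case (7 f a b)
    then have *: "nat_trans A B f" "Src f = a" by (auto simp: in_Hom_functor_cat)
    have "Cmp f = (\<lambda>x\<in>Obj A. Cmp f x \<cdot>\<^bsub>B\<^esub> Ide B (FO a x))"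
      by (rule extensionalityI[OF nat_trans.Cmp_ext[OF *(1)]])
        (use * nat_trans.Cmp_Hom[OF *(1)] in \<open>auto intro!: B.Comp_Ide_right[symmetric]\<close>)
    from this[symmetric] *(2) show ?case
      by (intro ntr_eqI) (simp_all add: functor_cat_simps cong: restrict_cong)
  qed
qed

section \<open>Horizontal composition and interchange\<close>

lemma hcomp_simps [simp]:
  "Src (hcomp A C \<beta> \<alpha>) = comp_functor A (Src \<beta>) (Src \<alpha>)"
  "Trg (hcomp A C \<beta> \<alpha>) = comp_functor A (Trg \<beta>) (Trg \<alpha>)"
  "a \<in> Obj A \<Longrightarrow> Cmp (hcomp A C \<beta> \<alpha>) a = Cmp \<beta> (FO (Trg \<alpha>) a) \<cdot>\<^bsub>C\<^esub> FA (Src \<beta>) (Cmp \<alpha> a)"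
  by (simp_all add: hcomp_def)

lemma nat_trans_hcomp:
  assumes "nat_trans A B \<alpha>" "nat_trans B C \<beta>"
  shows "nat_trans A C (hcomp A C \<beta> \<alpha>)"
proof -
  interpret a: nat_trans A B \<alpha> by fact
  interpret b: nat_trans B C \<beta> by fact
  show ?thesis
  proof (intro nat_trans.intro, goal_cases)
    case 3 show ?case
      unfolding nat_trans_axioms_def
    proof (intro conjI allI impI, goal_cases)
      case (2 x) then show ?case
        using b.S.B.Comp_Hom[OF b.S.FA_Hom[OF a.Cmp_Hom[OF 2]] b.Cmp_Hom[OF a.T.FO_Obj[OF 2]]] by
            simp
    next
      case (3 f x y)
      then have xy: "x \<in> Obj A" "y \<in> Obj A" "f \<in> Arr A"
        using a.S.A.Dom_Obj a.S.A.Cod_Obj by (auto simp: in_Hom_iff)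
      note bx = b.Cmp_Hom[OF a.T.FO_Obj[OF xy(1)]] and bfy = b.Cmp_Hom[OF a.T.FO_Obj[OF xy(2)]]
      note ax = b.S.FA_Hom[OF a.Cmp_Hom[OF xy(1)]] and ay = b.S.FA_Hom[OF a.Cmp_Hom[OF xy(2)]]
      note sf = b.S.FA_Hom[OF a.S.FA_Hom[OF 3]] and tf = b.S.FA_Hom[OF a.T.FA_Hom[OF 3]]
      note tf' = b.T.FA_Hom[OF a.T.FA_Hom[OF 3]]
      have "FA (Src \<beta>) (Cmp \<alpha> y) \<cdot>\<^bsub>C\<^esub> FA (Src \<beta>) (FA (Src \<alpha>) f)
          = FA (Src \<beta>) (FA (Trg \<alpha>) f) \<cdot>\<^bsub>C\<^esub> FA (Src \<beta>) (Cmp \<alpha> x)"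
        using b.S.FA_Comp[OF a.S.FA_Hom[OF 3] a.Cmp_Hom[OF xy(2)]]
          b.S.FA_Comp[OF a.Cmp_Hom[OF xy(1)] a.T.FA_Hom[OF 3]] a.naturality[OF 3] by simp
      then show ?case
        using xy b.naturality[OF a.T.FA_Hom[OF 3]] b.S.B.Comp_assoc[OF sf ay bfy]
          b.S.B.Comp_assoc[OF ax tf bfy] b.S.B.Comp_assoc[OF ax bx tf'] by simp
    qed (simp add: hcomp_def)
  qed (auto intro: is_functor_comp a.S.is_functor_axioms b.S.is_functor_axioms
      a.T.is_functor_axioms b.T.is_functor_axioms)
qed

lemma Cat_simps [simp]:
  "Obj0 Cat = {A. category A}"
  "Hom2 Cat = functor_cat"
  "One Cat = id_functor"
  "Comp1 Cat A B C = comp_functor A"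
  "Comp2 Cat A B C = hcomp A C"
  by (simp_all add: Cat_def)

text \<open>Together with \<open>hcomp_Ide_right\<close> this evaluates whiskerings in
  \<open>Cat\<close>: on one side a functor is applied to a component, on the other a component is
  taken at the image of an object. Every axiom stated with whiskerings is later read off through
  these two rules.\<close>

lemma hcomp_Ide_left:
  assumes "nat_trans A B \<alpha>" "is_functor B C G" "a \<in> Obj A"
  shows "Cmp (hcomp A C (Ide (functor_cat B C) G) \<alpha>) a = FA G (Cmp \<alpha> a)"
proof -
  interpret a: nat_trans A B \<alpha> by fact
  interpret G: is_functor B C G by fact
  show ?thesis
    using assms G.B.Comp_Ide_left[OF G.FA_Hom[OF a.Cmp_Hom[OF assms(3)]]]
    by (simp add: functor_cat_simps a.T.FO_Obj)
qed

lemma hcomp_Ide_right: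
  assumes "nat_trans B C \<beta>" "is_functor A B F" "a \<in> Obj A"
  shows "Cmp (hcomp A C \<beta> (Ide (functor_cat A B) F)) a = Cmp \<beta> (FO F a)"
proof -
  interpret b: nat_trans B C \<beta> by fact
  interpret F: is_functor A B F by fact
  show ?thesis
    using assms b.S.B.Comp_Ide_right[OF b.Cmp_Hom[OF F.FO_Obj[OF assms(3)]]]
    by (simp add: functor_cat_simps b.S.FA_Ide F.FO_Obj)
qed

lemma hcomp_interchange:
  assumes "nat_trans A B \<alpha>" "nat_trans A B \<alpha>'" "Trg \<alpha> = Src \<alpha>'"
    and "nat_trans B C \<beta>" "nat_trans B C \<beta>'" "Trg \<beta> = Src \<beta>'"
  shows "hcomp A C (\<beta>' \<cdot>\<^bsub>functor_cat B C\<^esub> \<beta>) (\<alpha>' \<cdot>\<^bsub>functor_cat A B\<^esub> \<alpha>)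
    = hcomp A C \<beta>' \<alpha>' \<cdot>\<^bsub>functor_cat A C\<^esub> hcomp A C \<beta> \<alpha>"
proof -
  interpret a: nat_trans A B \<alpha> by fact
  interpret a': nat_trans A B \<alpha>' by fact
  interpret b: nat_trans B C \<beta> by fact
  interpret b': nat_trans B C \<beta>' by fact
  have "(Cmp \<beta>' (FO (Trg \<alpha>') x) \<cdot>\<^bsub>C\<^esub> Cmp \<beta> (FO (Trg \<alpha>') x)) \<cdot>\<^bsub>C\<^esub> FA (Src \<beta>) (Cmp \<alpha>' x \<cdot>\<^bsub>B\<^esub> Cmp \<alpha>
      x) =
      (Cmp \<beta>' (FO (Trg \<alpha>') x) \<cdot>\<^bsub>C\<^esub> FA (Src \<beta>') (Cmp \<alpha>' x)) \<cdot>\<^bsub>C\<^esub>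
      (Cmp \<beta> (FO (Trg \<alpha>) x) \<cdot>\<^bsub>C\<^esub> FA (Src \<beta>) (Cmp \<alpha> x))" (is "(?b' \<cdot>\<^bsub>C\<^esub> ?b) \<cdot>\<^bsub>C\<^esub> _ = (_ \<cdot>\<^bsub>C\<^esub> ?a'')
          \<cdot>\<^bsub>C\<^esub> (?b'' \<cdot>\<^bsub>C\<^esub> ?a)")
    if x: "x \<in> Obj A" for x
  proof -
    note ax = a.Cmp_Hom[OF x] and ax' = a'.Cmp_Hom[OF x, folded assms(3)]
    let ?a' = "FA (Src \<beta>) (Cmp \<alpha>' x)"
    note h = b.S.FA_Hom[OF ax] b.S.FA_Hom[OF ax'] b.Cmp_Hom[OF a'.T.FO_Obj[OF x]]
      b'.Cmp_Hom[OF a'.T.FO_Obj[OF x], folded assms(6)] b.Cmp_Hom[OF a.T.FO_Obj[OF x]]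
      b'.S.FA_Hom[OF ax', folded assms(6)]
    have "(?b' \<cdot>\<^bsub>C\<^esub> ?b) \<cdot>\<^bsub>C\<^esub> FA (Src \<beta>) (Cmp \<alpha>' x \<cdot>\<^bsub>B\<^esub> Cmp \<alpha> x) = (?b' \<cdot>\<^bsub>C\<^esub> ?b) \<cdot>\<^bsub>C\<^esub> (?a' \<cdot>\<^bsub>C\<^esub> ?a)"
      by (simp add: b.S.FA_Comp[OF ax ax'])
    also have "\<dots> = ?b' \<cdot>\<^bsub>C\<^esub> ((?b \<cdot>\<^bsub>C\<^esub> ?a') \<cdot>\<^bsub>C\<^esub> ?a)"
      using b.S.B.Comp_assoc[OF b.S.B.Comp_Hom[OF h(1,2)] h(3,4)] b.S.B.Comp_assoc[OF h(1-3)] by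
          simp
    \<comment> \<open>The two inner factors are exchanged by naturality of \<beta> at the component
      of \<alpha>' at x; the rest of the chain is associativity and functoriality.\<close>
    also have "?b \<cdot>\<^bsub>C\<^esub> ?a' = ?a'' \<cdot>\<^bsub>C\<^esub> ?b''"
      using b.naturality[OF ax'] assms(6) by simp
    also have "?b' \<cdot>\<^bsub>C\<^esub> ((?a'' \<cdot>\<^bsub>C\<^esub> ?b'') \<cdot>\<^bsub>C\<^esub> ?a) = (?b' \<cdot>\<^bsub>C\<^esub> ?a'') \<cdot>\<^bsub>C\<^esub> (?b'' \<cdot>\<^bsub>C\<^esub> ?a)"
      using b.S.B.Comp_assoc[OF b.S.B.Comp_Hom[OF h(1,5)] h(6,4)] b.S.B.Comp_assoc[OF h(1,5,6)] by
          (simp add: assms(6))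
    finally show ?thesis .
  qed
  then show ?thesis
    by (auto intro!: ntr_eqI simp: functor_cat_simps hcomp_def fun_eq_iff restrict_def a'.T.FO_Obj)
qed

text \<open>A 2-functor into \<open>Cat\<close> presupposes these laws. The laws for 1-cells hold
  strictly because functors are extensional records; the laws for 2-cells are compared one component
  at a time.\<close>

lemma two_category_Cat: "two_category Cat"
proof (rule two_category.intro, goal_cases)
  case (1 A B) then show ?case by (simp add: category_functor_cat)
next
  case (2 A) then show ?case by (simp add: functor_cat_simps is_functor_id)
next
  case (3 A B C F G) then show ?case by (simp add: functor_cat_simps is_functor_comp)
next
  case (4 A B C \<alpha> F F' \<beta> G G') then show ?case by (auto simp: in_Hom_functor_cat nat_trans_hcomp)
next
  case (5 A B C F G)
  then have FG: "is_functor A B F" "is_functor B C G" by (auto simp: functor_cat_simps)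
  show ?case
    unfolding Cat_simps
    by (rule nat_trans_eqI[OF nat_trans_hcomp[OF nat_trans_Ide nat_trans_Ide] nat_trans_Ide])
      (use FG hcomp_Ide_right[OF nat_trans_Ide[OF FG(2)] FG(1)] in
        \<open>auto simp: is_functor_comp functor_cat_simps is_functor.FO_Obj\<close>)
next
  case (6 A B C \<alpha> F F' \<alpha>' F'' \<beta> G G' \<beta>' G'')
  then show ?case unfolding Cat_simps by (auto simp: in_Hom_functor_cat intro!: hcomp_interchange)
next
  case (7 A B F) then show ?case by (simp add: functor_cat_simps comp_functor_id)
next
  case (8 A B F) then show ?case by (simp add: functor_cat_simps comp_functor_id)
next
  case (9 A B \<alpha>)
  then have a: "nat_trans A B \<alpha>" "category B" by (auto simp: functor_cat_simps)
  show ?case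
    unfolding Cat_simps
    by (rule nat_trans_eqI[OF nat_trans_hcomp[OF a(1) nat_trans_Ide[OF is_functor_id]] a(1)])
      (use a hcomp_Ide_left[OF a(1) is_functor_id[OF a(2)]] nat_trans.Cmp_Hom[OF a(1)] in
        \<open>auto simp: functor_cat_simps comp_functor_id nat_trans_def in_Hom_iff\<close>)
next
  case (10 A B \<alpha>)
  then have a: "nat_trans A B \<alpha>" "category A" by (auto simp: functor_cat_simps)
  show ?case
    unfolding Cat_simps
    by (rule nat_trans_eqI[OF nat_trans_hcomp[OF nat_trans_Ide[OF is_functor_id] a(1)] a(1)])
      (use a hcomp_Ide_right[OF a(1) is_functor_id[OF a(2)]] in
        \<open>auto simp: functor_cat_simps comp_functor_id nat_trans_def\<close>)
next
  case (11 A B C E F G H) then show ?case by (simp add: functor_cat_simps comp_functor_assoc)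
next
  case (12 A B C E \<alpha> \<beta> \<gamma>)
  then have n: "nat_trans A B \<alpha>" "nat_trans B C \<beta>" "nat_trans C E \<gamma>" by (auto simp:
      functor_cat_simps)
  interpret a: nat_trans A B \<alpha> by (rule n)
  interpret b: nat_trans B C \<beta> by (rule n)
  interpret c: nat_trans C E \<gamma> by (rule n)
  show ?case
    unfolding Cat_simps
  proof (rule nat_trans_eqI[OF nat_trans_hcomp[OF n(1) nat_trans_hcomp[OF n(2,3)]]
      nat_trans_hcomp[OF nat_trans_hcomp[OF n(1,2)] n(3)]])
    fix x assume x: "x \<in> Obj A"
    note h = b.S.FA_Hom[OF a.Cmp_Hom[OF x]] b.Cmp_Hom[OF a.T.FO_Obj[OF x]]
    have "Cmp \<alpha> x \<in> Arr B" using a.Cmp_Hom[OF x] by (simp add: in_Hom_iff)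
    \<comment> \<open>The source functor of \<gamma> is distributed over the composite that defines
      the component of \<beta> with \<alpha>; what remains is associativity of three arrows in
      \<open>E\<close>.\<close>
    then show "Cmp (hcomp A E (hcomp B E \<gamma> \<beta>) \<alpha>) x = Cmp (hcomp A E \<gamma> (hcomp A C \<beta> \<alpha>)) x"
      using x c.S.FA_Comp[OF h] a.T.FO_Obj[OF x]
        c.S.B.Comp_assoc[OF c.S.FA_Hom[OF h(1)] c.S.FA_Hom[OF h(2)] c.Cmp_Hom[OF b.T.FO_Obj[OF
            a.T.FO_Obj[OF x]]]]
      by simp
  qed (simp_all add: comp_functor_assoc[OF a.S.is_functor_axioms] comp_functor_assoc[OF
      a.T.is_functor_axioms])
qed

section \<open>The category of quasi-natural transformations\<close>

lemma modif_eqI: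
  fixes \<Sigma> \<Sigma>' :: "('c, 'o, 'p, 'n) modif"
  shows "MSrc \<Sigma> = MSrc \<Sigma>' \<Longrightarrow> MTrg \<Sigma> = MTrg \<Sigma>' \<Longrightarrow> MCmp \<Sigma> = MCmp \<Sigma>' \<Longrightarrow> \<Sigma> = \<Sigma>'"
  by (cases \<Sigma>, cases \<Sigma>') simp

lemma modification_eqI:
  assumes "modification D E F F' \<Sigma>" "modification D E F F' \<Sigma>'" "MSrc \<Sigma> = MSrc \<Sigma>'" "MTrg \<Sigma> = MTrg \<Sigma>'"
    and "\<And>a. a \<in> Obj0 D \<Longrightarrow> MCmp \<Sigma> a = MCmp \<Sigma>' a"
  shows "\<Sigma> = \<Sigma>'"
  using assms modification.MCmp_ext[OF assms(1)] modification.MCmp_ext[OF assms(2)]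
  by (intro modif_eqI) (auto intro: extensionalityI)

lemma qNat_simps:
  "Obj (qNat D E F F') = {\<sigma>. quasi_natural D E F F' \<sigma>}"
  "Arr (qNat D E F F') = {\<Sigma>. modification D E F F' \<Sigma>}"
  "Dom (qNat D E F F') = MSrc"
  "Cod (qNat D E F F') = MTrg"
  "Ide (qNat D E F F') \<sigma> = \<lparr>MSrc = \<sigma>, MTrg = \<sigma>,
     MCmp = (\<lambda>a\<in>Obj0 D. Ide (Hom2 E (F0 F a) (F0 F' a)) (Q1 \<sigma> a))\<rparr>"
  "\<Sigma>' \<cdot>\<^bsub>qNat D E F F'\<^esub> \<Sigma> = \<lparr>MSrc = MSrc \<Sigma>, MTrg = MTrg \<Sigma>',
     MCmp = (\<lambda>a\<in>Obj0 D. MCmp \<Sigma>' a \<cdot>\<^bsub>Hom2 E (F0 F a) (F0 F' a)\<^esub> MCmp \<Sigma> a)\<rparr>"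
  by (simp_all add: qNat_def)

lemma in_Hom_qNat:
  "\<Sigma> \<in> Hom (qNat D E F F') \<sigma> \<tau> \<longleftrightarrow> modification D E F F' \<Sigma> \<and> MSrc \<Sigma> = \<sigma> \<and> MTrg \<Sigma> = \<tau>"
  by (simp add: in_Hom_iff qNat_simps)

context two_functor
begin

lemma F2_Hom:
  assumes "a \<in> Obj0 D" "b \<in> Obj0 D" "\<alpha> \<in> Hom (Hom2 D a b) f f'"
  shows "F2 F a b \<alpha> \<in> Hom (Hom2 E (F0 F a) (F0 F b)) (F1 F a b f) (F1 F a b f')"
  by (rule is_functor.FA_Hom[OF F_hom_functor[OF assms(1,2)] assms(3)])

lemma F1_Obj:
  assumes "a \<in> Obj0 D" "b \<in> Obj0 D" "f \<in> Obj (Hom2 D a b)"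
  shows "F1 F a b f \<in> Obj (Hom2 E (F0 F a) (F0 F b))"
  by (rule is_functor.FO_Obj[OF F_hom_functor[OF assms(1,2)] assms(3)])

lemma F2_Ide:
  assumes "a \<in> Obj0 D" "b \<in> Obj0 D" "f \<in> Obj (Hom2 D a b)"
  shows "F2 F a b (Ide (Hom2 D a b) f) = Ide (Hom2 E (F0 F a) (F0 F b)) (F1 F a b f)"
  by (rule is_functor.FA_Ide[OF F_hom_functor[OF assms(1,2)] assms(3)])

end

text \<open>For a family of identities both horizontal composites are whiskerings, and the
  modification axiom becomes \<open>Q2_natural\<close>.\<close>

lemma modification_Ide:
  assumes "quasi_natural D E F F' \<sigma>"
  shows "modification D E F F' (Ide (qNat D E F F') \<sigma>)"
proof -
  interpret s: quasi_natural D E F F' \<sigma> by fact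
  show ?thesis
    unfolding qNat_simps
  proof (intro modification.intro, goal_cases)
    case 3 show ?case
    proof (unfold_locales, goal_cases)
      case (2 a) then show ?case
        using category.Ide_Hom[OF s.F.E.category_Hom2 s.Q1_Obj] s.F.F0_Obj0 s.F'.F0_Obj0 by simp
    next
      case (3 a b \<alpha> f f') then show ?case
        using s.Q2_natural[OF 3] by (simp add: whisker_left_def whisker_right_def)
    qed simp
  qed (simp_all add: assms)
qed

lemma modification_Comp:
  assumes "modification D E F F' \<Sigma>" "modification D E F F' \<Sigma>'" "MTrg \<Sigma> = MSrc \<Sigma>'"
  shows "modification D E F F' (\<Sigma>' \<cdot>\<^bsub>qNat D E F F'\<^esub> \<Sigma>)"
proof -
  interpret s: modification D E F F' \<Sigma> by fact
  interpret t: modification D E F F' \<Sigma>' by fact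
  show ?thesis
    unfolding qNat_simps
  proof (intro modification.intro, goal_cases)
    case 3 show ?case
    proof (unfold_locales, goal_cases)
      case (2 a) then show ?case
        using category.Comp_Hom[OF s.S.F.E.category_Hom2 s.MCmp_Hom t.MCmp_Hom[folded assms(3)]]
          s.S.F.F0_Obj0 s.S.F'.F0_Obj0 by simp
    next
      case (3 a b \<alpha> f f')
      note ab = 3(1,2)
      note Oab = s.S.F.F0_Obj0[OF ab(1)] s.S.F.F0_Obj0[OF ab(2)]
        s.S.F'.F0_Obj0[OF ab(1)] s.S.F'.F0_Obj0[OF ab(2)]
      interpret Dab: category "Hom2 D a b" by (rule s.S.F.D.category_Hom2[OF ab])
      interpret C: category "Hom2 E (F0 F a) (F0 F' b)" by (rule s.S.F.E.category_Hom2[OF Oab(1,4)])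
      interpret Fab: category "Hom2 E (F0 F a) (F0 F b)" by (rule s.S.F.E.category_Hom2[OF
          Oab(1,2)])
      interpret F'ab: category "Hom2 E (F0 F' a) (F0 F' b)" by (rule s.S.F.E.category_Hom2[OF
          Oab(3,4)])
      let ?c = "Comp (Hom2 E (F0 F a) (F0 F' b))"
      let ?h = "Comp2 E (F0 F a) (F0 F b) (F0 F' b)" and ?h' = "Comp2 E (F0 F a) (F0 F' a) (F0 F'
          b)"
      \<comment> \<open>The modification axiom involves full horizontal composites with \<alpha>, so
        \<alpha> is factored as \<alpha> after the identity of f. Interchange then separates the two
        modifications: \<Sigma>' is used at \<alpha> and \<Sigma> at the identity, with the 2-cell
        of the middle transformation at f passing between them.\<close>
      let ?i = "Ide (Hom2 D a b) f"
      have f: "f \<in> Obj (Hom2 D a b)" "f' \<in> Obj (Hom2 D a b)"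
        using 3 Dab.Dom_Obj Dab.Cod_Obj by (auto simp: in_Hom_iff)
      note i = Dab.Ide_Hom[OF f(1)]
      note sa = s.MCmp_Hom[OF ab(1)] and sb = s.MCmp_Hom[OF ab(2)]
      note ta = t.MCmp_Hom[OF ab(1), folded assms(3)] and tb = t.MCmp_Hom[OF ab(2), folded assms(3)]
      note Fa = s.S.F.F2_Hom[OF 3] and F'a = s.S.F'.F2_Hom[OF 3]
      note Fi = s.S.F.F2_Hom[OF ab i] and F'i = s.S.F'.F2_Hom[OF ab i]
      note s2 = s.S.Q2_Hom[OF ab f(1)] and t2 = s.T.Q2_Hom[OF ab f(1)] and t2' = t.T.Q2_Hom[OF ab
          f(2)]
      have "?h (MCmp \<Sigma>' b \<cdot>\<^bsub>Hom2 E (F0 F b) (F0 F' b)\<^esub> MCmp \<Sigma> b) (F2 F a b \<alpha>)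
        = ?c (?h (MCmp \<Sigma>' b) (F2 F a b \<alpha>)) (?h (MCmp \<Sigma> b) (F2 F a b ?i))"
        using s.S.F.E.interchange[OF Oab(1,2,4) Fi Fa sb tb] Fab.Comp_Ide_right[OF Fa]
        by (simp add: s.S.F.F2_Ide[OF ab f(1)])
      moreover have "?h' (F2 F' a b \<alpha>) (MCmp \<Sigma>' a \<cdot>\<^bsub>Hom2 E (F0 F a) (F0 F' a)\<^esub> MCmp \<Sigma> a)
        = ?c (?h' (F2 F' a b \<alpha>) (MCmp \<Sigma>' a)) (?h' (F2 F' a b ?i) (MCmp \<Sigma> a))"
        using s.S.F.E.interchange[OF Oab(1,3,4) sa ta F'i F'a] F'ab.Comp_Ide_right[OF F'a]
        by (simp add: s.S.F'.F2_Ide[OF ab f(1)])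
      moreover have "?c (Q2 (MTrg \<Sigma>') (a, b, f')) (?c (?h (MCmp \<Sigma>' b) (F2 F a b \<alpha>)) (?h (MCmp \<Sigma> b)
          (F2 F a b ?i)))
        = ?c (?c (?h' (F2 F' a b \<alpha>) (MCmp \<Sigma>' a)) (?h' (F2 F' a b ?i) (MCmp \<Sigma> a))) (Q2 (MSrc \<Sigma>) (a,
            b, f))"
        using t.MCmp_natural[OF 3] s.MCmp_natural[OF ab i]
          C.Comp_assoc[OF s.S.F.E.Comp2_Hom[OF Oab(1,2,4) Fi sb] s.S.F.E.Comp2_Hom[OF Oab(1,2,4)
              Fa tb] t2']
          C.Comp_assoc[OF s.S.F.E.Comp2_Hom[OF Oab(1,2,4) Fi sb] t2 s.S.F.E.Comp2_Hom[OF
              Oab(1,3,4) ta F'a]]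
          C.Comp_assoc[OF s2 s.S.F.E.Comp2_Hom[OF Oab(1,3,4) sa F'i] s.S.F.E.Comp2_Hom[OF
              Oab(1,3,4) ta F'a]]
        by (simp add: assms(3))
      ultimately show ?case using ab by simp
    qed simp
  qed (simp_all add: s.S.quasi_natural_axioms t.T.quasi_natural_axioms)
qed

text \<open>All laws hold componentwise in the hom-categories of \<open>E\<close>. That the relevant
  0-cells lie in \<open>E\<close> is drawn from the cells themselves, since a quasi-natural
  transformation includes the 2-functor laws of \<open>F\<close> and \<open>F'\<close>.\<close>

lemma category_qNat: "category (qNat D E F F')"
proof (unfold_locales, goal_cases)
  case (1 \<Sigma>) then show ?case by (simp add: qNat_simps modification_def)
next
  case (2 \<Sigma>) then show ?case by (simp add: qNat_simps modification_def)
next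
  case (3 \<sigma>) then show ?case
    using modification_Ide[of D E F F' \<sigma>] by (simp add: in_Hom_qNat) (simp add: qNat_simps)
next
  case (4 \<Sigma> \<sigma> \<tau> \<Sigma>' \<rho>) then show ?case
    using modification_Comp[of D E F F' \<Sigma> \<Sigma>'] by (simp add: in_Hom_qNat) (simp add: qNat_simps)
next
  case (5 S1 a b S2 c S3)
  then have *: "modification D E F F' S1" "modification D E F F' S2" "modification D E F F' S3"
    "MTrg S1 = MSrc S2" "MTrg S2 = MSrc S3"
    by (auto simp: in_Hom_qNat)
  interpret s: modification D E F F' S1 by (rule *)
  have cat: "x \<in> Obj0 D \<Longrightarrow> category (Hom2 E (F0 F x) (F0 F' x))" for x
    by (simp add: s.S.F.E.category_Hom2 s.S.F.F0_Obj0 s.S.F'.F0_Obj0)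
  show ?case
    unfolding qNat_simps
    using * cat s.MCmp_Hom modification.MCmp_Hom[OF *(2)] modification.MCmp_Hom[OF *(3)]
    by (auto simp: fun_eq_iff restrict_def intro!: category.Comp_assoc)
next
  case (6 \<Sigma> \<sigma> \<tau>)
  then have *: "modification D E F F' \<Sigma>" "MTrg \<Sigma> = \<tau>" by (auto simp: in_Hom_qNat)
  interpret s: modification D E F F' \<Sigma> by (rule *)
  have "MCmp \<Sigma> = (\<lambda>x\<in>Obj0 D. Ide (Hom2 E (F0 F x) (F0 F' x)) (Q1 \<tau> x) \<cdot>\<^bsub>Hom2 E (F0 F x) (F0 F' x)\<^esub>
      MCmp \<Sigma> x)"
    by (rule extensionalityI[OF s.MCmp_ext])
      (use *(2) s.MCmp_Hom s.S.F.E.category_Hom2 s.S.F.F0_Obj0 s.S.F'.F0_Obj0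
        in \<open>auto intro!: category.Comp_Ide_left[symmetric]\<close>)
  from this[symmetric] *(2) show ?case
    by (intro modif_eqI) (simp_all add: qNat_simps cong: restrict_cong)
next
  case (7 \<Sigma> \<sigma> \<tau>)
  then have *: "modification D E F F' \<Sigma>" "MSrc \<Sigma> = \<sigma>" by (auto simp: in_Hom_qNat)
  interpret s: modification D E F F' \<Sigma> by (rule *)
  have "MCmp \<Sigma> = (\<lambda>x\<in>Obj0 D. MCmp \<Sigma> x \<cdot>\<^bsub>Hom2 E (F0 F x) (F0 F' x)\<^esub> Ide (Hom2 E (F0 F x) (F0 F' x))
      (Q1 \<sigma> x))"
    by (rule extensionalityI[OF s.MCmp_ext])
      (use *(2) s.MCmp_Hom s.S.F.E.category_Hom2 s.S.F.F0_Obj0 s.S.F'.F0_Obj0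
        in \<open>auto intro!: category.Comp_Ide_right[symmetric]\<close>)
  from this[symmetric] *(2) show ?case
    by (intro modif_eqI) (simp_all add: qNat_simps cong: restrict_cong)
qed

section \<open>Representable 2-functors\<close>

context two_category
begin

lemma Dom_Cod_Hom2:
  assumes "a \<in> Obj0 D" "b \<in> Obj0 D" "\<alpha> \<in> Hom (Hom2 D a b) f f'"
  shows "f \<in> Obj (Hom2 D a b)" "f' \<in> Obj (Hom2 D a b)"
  using assms category.Dom_Obj[OF category_Hom2] category.Cod_Obj[OF category_Hom2]
  by (auto simp: in_Hom_iff)

lemma Ide_Hom2:
  "a \<in> Obj0 D \<Longrightarrow> b \<in> Obj0 D \<Longrightarrow> f \<in> Obj (Hom2 D a b) \<Longrightarrow> Ide (Hom2 D a b) f \<in> Hom (Hom2 D a b) f f"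
  by (rule category.Ide_Hom[OF category_Hom2])

text \<open>Interchange applied to pairs in which one member is an identity. Equating the two
  factorizations gives the naturality square of a 2-cell acting on a representable.\<close>

lemma Comp2_whiskers:
  assumes "a \<in> Obj0 D" "b \<in> Obj0 D" "c \<in> Obj0 D"
    and "\<alpha> \<in> Hom (Hom2 D a b) f f'" "\<beta> \<in> Hom (Hom2 D b c) g g'"
  shows "Comp2 D a b c \<beta> (Ide (Hom2 D a b) f') \<cdot>\<^bsub>Hom2 D a c\<^esub> Comp2 D a b c (Ide (Hom2 D b c) g) \<alpha>
      = Comp2 D a b c \<beta> \<alpha>" (is ?thesis1)
    and "Comp2 D a b c (Ide (Hom2 D b c) g') \<alpha> \<cdot>\<^bsub>Hom2 D a c\<^esub> Comp2 D a b c \<beta> (Ide (Hom2 D a b) f)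
      = Comp2 D a b c \<beta> \<alpha>" (is ?thesis2)
proof -
  interpret ab: category "Hom2 D a b" using assms by (rule_tac category_Hom2)
  interpret bc: category "Hom2 D b c" using assms by (rule_tac category_Hom2)
  note f = Dom_Cod_Hom2[OF assms(1,2,4)] and g = Dom_Cod_Hom2[OF assms(2,3,5)]
  show ?thesis1
    using interchange[OF assms(1-3) assms(4) ab.Ide_Hom[OF f(2)] bc.Ide_Hom[OF g(1)] assms(5)]
      ab.Comp_Ide_left[OF assms(4)] bc.Comp_Ide_right[OF assms(5)] by simp
  show ?thesis2
    using interchange[OF assms(1-3) ab.Ide_Hom[OF f(1)] assms(4,5) bc.Ide_Hom[OF g(2)]]
      ab.Comp_Ide_right[OF assms(4)] bc.Comp_Ide_left[OF assms(5)] by simp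
qed

lemma Comp2_Arr:
  assumes "a \<in> Obj0 D" "b \<in> Obj0 D" "c \<in> Obj0 D" "\<alpha> \<in> Arr (Hom2 D a b)" "\<beta> \<in> Arr (Hom2 D b c)"
  shows "Comp2 D a b c \<beta> \<alpha> \<in> Arr (Hom2 D a c)"
    and "Dom (Hom2 D a c) (Comp2 D a b c \<beta> \<alpha>) = Comp1 D a b c (Dom (Hom2 D b c) \<beta>) (Dom (Hom2 D a
        b) \<alpha>)"
    and "Cod (Hom2 D a c) (Comp2 D a b c \<beta> \<alpha>) = Comp1 D a b c (Cod (Hom2 D b c) \<beta>) (Cod (Hom2 D a
        b) \<alpha>)"
  using Comp2_Hom[OF assms(1-3) Arr_in_Hom Arr_in_Hom] assms(4,5) by (auto simp: in_Hom_iff)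

lemma Ide_Arr:
  assumes "a \<in> Obj0 D" "b \<in> Obj0 D" "f \<in> Obj (Hom2 D a b)"
  shows "Ide (Hom2 D a b) f \<in> Arr (Hom2 D a b)"
    "Dom (Hom2 D a b) (Ide (Hom2 D a b) f) = f" "Cod (Hom2 D a b) (Ide (Hom2 D a b) f) = f"
  using Ide_Hom2[OF assms] by (auto simp: in_Hom_iff)

lemma Dom_Cod_Obj:
  assumes "a \<in> Obj0 D" "b \<in> Obj0 D" "\<alpha> \<in> Arr (Hom2 D a b)"
  shows "Dom (Hom2 D a b) \<alpha> \<in> Obj (Hom2 D a b)" "Cod (Hom2 D a b) \<alpha> \<in> Obj (Hom2 D a b)"
  using Dom_Cod_Hom2[OF assms(1,2) Arr_in_Hom[OF assms(3)]] by auto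

end

lemma representable_simps [simp]:
  "F0 (representable D r) = Hom2 D r"
  "\<lbrakk>f \<in> Obj (Hom2 D a b); g \<in> Obj (Hom2 D r a)\<rbrakk> \<Longrightarrow>
    FO (F1 (representable D r) a b f) g = Comp1 D r a b f g"
  "\<lbrakk>f \<in> Obj (Hom2 D a b); \<gamma> \<in> Arr (Hom2 D r a)\<rbrakk> \<Longrightarrow>
    FA (F1 (representable D r) a b f) \<gamma> = Comp2 D r a b (Ide (Hom2 D a b) f) \<gamma>"
  "\<lbrakk>\<alpha> \<in> Arr (Hom2 D a b); g \<in> Obj (Hom2 D r a)\<rbrakk> \<Longrightarrow>
    Cmp (F2 (representable D r) a b \<alpha>) g = Comp2 D r a b \<alpha> (Ide (Hom2 D r a) g)"
  by (simp_all add: representable_def Let_def whisker_left_def whisker_right_def)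

context two_category
begin

lemma representable_Src_Trg:
  assumes "a \<in> Obj0 D" "b \<in> Obj0 D" "\<alpha> \<in> Arr (Hom2 D a b)"
  shows "Src (F2 (representable D r) a b \<alpha>) = F1 (representable D r) a b (Dom (Hom2 D a b) \<alpha>)"
    "Trg (F2 (representable D r) a b \<alpha>) = F1 (representable D r) a b (Cod (Hom2 D a b) \<alpha>)"
  using assms Dom_Cod_Obj[OF assms] by (simp_all add: representable_def Let_def)

lemma is_functor_representable:
  assumes "r \<in> Obj0 D" "a \<in> Obj0 D" "b \<in> Obj0 D" "f \<in> Obj (Hom2 D a b)"
  shows "is_functor (Hom2 D r a) (Hom2 D r b) (F1 (representable D r) a b f)"
proof -
  interpret ra: category "Hom2 D r a" using assms by (rule_tac category_Hom2)
  interpret rb: category "Hom2 D r b" using assms by (rule_tac category_Hom2)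
  interpret ab: category "Hom2 D a b" using assms by (rule_tac category_Hom2)
  note i = Ide_Hom2[OF assms(2-4)]
  show ?thesis
  proof (unfold_locales, goal_cases)
    case 1 show ?case using assms by (simp add: representable_def)
  next
    case 2 show ?case using assms by (simp add: representable_def)
  next
    case (3 g) then show ?case using assms by (simp add: Comp1_Obj)
  next
    case (4 \<gamma> g g')
    note g = Dom_Cod_Hom2[OF assms(1,2) 4]
    show ?case using Comp2_Hom[OF assms(1-3) 4 i] 4 g assms by (simp add: in_Hom_iff)
  next
    case (5 g) then show ?case using assms by (simp add: Ide_Arr Comp2_Ide)
  next
    case (6 \<gamma> g g' \<gamma>' g'')
    have "\<gamma> \<in> Arr (Hom2 D r a)" "\<gamma>' \<in> Arr (Hom2 D r a)" "\<gamma>' \<cdot>\<^bsub>Hom2 D r a\<^esub> \<gamma> \<in> Arr (Hom2 D r a)"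
      using 6 ra.Comp_Hom[OF 6] by (auto simp: in_Hom_iff)
    \<comment> \<open>The identity of f is written as its own square, so interchange distributes
      whiskering with f over the composite.\<close>
    then show ?case
      using interchange[OF assms(1-3) 6 i i] ab.Comp_Ide_left[OF i] assms by simp
  qed
qed

lemma nat_trans_representable:
  assumes "r \<in> Obj0 D" "a \<in> Obj0 D" "b \<in> Obj0 D" "\<alpha> \<in> Arr (Hom2 D a b)"
  shows "nat_trans (Hom2 D r a) (Hom2 D r b) (F2 (representable D r) a b \<alpha>)"
proof -
  note st = representable_Src_Trg[OF assms(2-4)] and dc = Dom_Cod_Obj[OF assms(2-4)]
  note al = Arr_in_Hom[OF assms(4)]
  show ?thesis
  proof (intro nat_trans.intro, goal_cases)
    case 1 show ?case using st dc assms is_functor_representable by simp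
  next
    case 2 show ?case using st dc assms is_functor_representable by simp
  next
    case 3 show ?case
    proof (unfold_locales, goal_cases)
      case 1 show ?case using assms by (simp add: representable_def)
    next
      case (2 g) then show ?case
        using st dc assms Comp2_Hom[OF assms(1-3) Ide_Hom2[OF assms(1,2) 2] al] by simp
    next
      case (3 \<gamma> g g')
      then have "\<gamma> \<in> Arr (Hom2 D r a)" by (simp add: in_Hom_iff)
      then show ?case
        using st dc assms Comp2_whiskers[OF assms(1-3) 3 al] Dom_Cod_Hom2[OF assms(1,2) 3] by simp
    qed
  qed
qed

text \<open>Each law is a law of \<open>D\<close> with \<open>r\<close> as first 0-cell: interchange
  with an identity gives functoriality on 2-cells, the left unit laws give preservation of identity
  1-cells, and associativity gives preservation of composites.\<close>

lemma two_functor_representable: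
  assumes r: "r \<in> Obj0 D"
  shows "two_functor D Cat (representable D r)"
proof (intro two_functor.intro two_category_axioms two_category_Cat two_functor_axioms.intro,
    goal_cases)
  case (1 a) then show ?case by (simp add: category_Hom2 r)
next
  case (2 a b)
  interpret ab: category "Hom2 D a b" using 2 by (rule_tac category_Hom2)
  interpret ra: category "Hom2 D r a" using 2 r by (rule_tac category_Hom2)
  interpret Fab: category "functor_cat (Hom2 D r a) (Hom2 D r b)"
    using 2 r by (intro category_functor_cat category_Hom2)
  show ?case
    unfolding Cat_simps representable_simps(1)
  proof (unfold_locales, goal_cases)
    case 1 show ?case by (simp add: representable_def)
  next
    case 2 show ?case by (simp add: representable_def)
  next
    case (3 f) then show ?case using is_functor_representable 2 r by (simp add: functor_cat_simps)
  next
    case (4 \<alpha> f f') then show ?case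
      using nat_trans_representable[OF r 2] representable_Src_Trg[OF 2]
      by (auto simp: in_Hom_functor_cat) (auto simp: in_Hom_iff)
  next
    case (5 f)
    show ?case
    proof (rule nat_trans_eqI)
      show "nat_trans (Hom2 D r a) (Hom2 D r b) (F2 (representable D r) a b (Ide (Hom2 D a b) f))"
        using 5 2 r by (simp add: nat_trans_representable Ide_Arr)
      show "nat_trans (Hom2 D r a) (Hom2 D r b)
          (Ide (functor_cat (Hom2 D r a) (Hom2 D r b)) (F1 (representable D r) a b f))"
        using 5 2 r by (simp add: nat_trans_Ide is_functor_representable)
    qed (use 5 2 r in \<open>simp_all add: representable_Src_Trg Ide_Arr functor_cat_simps Comp2_Ide\<close>)
  next
    case (6 \<alpha> f f' \<alpha>' f'')
    then have A: "\<alpha> \<in> Arr (Hom2 D a b)" "\<alpha>' \<in> Arr (Hom2 D a b)" "\<alpha>' \<cdot>\<^bsub>Hom2 D a b\<^esub> \<alpha> \<in> Arr (Hom2 D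
        a b)"
      "Cod (Hom2 D a b) \<alpha> = Dom (Hom2 D a b) \<alpha>'"
      "Dom (Hom2 D a b) (\<alpha>' \<cdot>\<^bsub>Hom2 D a b\<^esub> \<alpha>) = Dom (Hom2 D a b) \<alpha>"
      "Cod (Hom2 D a b) (\<alpha>' \<cdot>\<^bsub>Hom2 D a b\<^esub> \<alpha>) = Cod (Hom2 D a b) \<alpha>'"
      using ab.Comp_Hom[OF 6] by (auto simp: in_Hom_iff)
    note nt = nat_trans_representable[OF r 2]
    show ?case
    proof (rule nat_trans_eqI[OF nt[OF A(3)] nat_trans_Comp[OF nt[OF A(1)] nt[OF A(2)]]])
      fix g assume g: "g \<in> Obj (Hom2 D r a)"
      note i = ra.Ide_Hom[OF g]
      show "Cmp (F2 (representable D r) a b (\<alpha>' \<cdot>\<^bsub>Hom2 D a b\<^esub> \<alpha>)) g =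
        Cmp (F2 (representable D r) a b \<alpha>' \<cdot>\<^bsub>functor_cat (Hom2 D r a) (Hom2 D r b)\<^esub> F2
            (representable D r) a b \<alpha>) g"
        using interchange[OF r 2 i i 6] ra.Comp_Ide_left[OF i] A g by (simp add: functor_cat_simps)
    qed (use A 2 in \<open>simp_all add: representable_Src_Trg functor_cat_simps\<close>)
  qed
next
  case (3 a)
  show ?case
    unfolding Cat_simps representable_simps(1)
    by (rule is_functor_eqI[OF is_functor_representable is_functor_id])
      (use 3 r in \<open>simp_all add: One_Obj category_Hom2 Comp1_One_left Comp2_One_left\<close>)
next
  case (4 a b c f g)
  show ?case
    unfolding Cat_simps representable_simps(1)
    by (rule is_functor_eqI[OF is_functor_representable
          is_functor_comp[OF is_functor_representable[OF r 4(1,2,4)] is_functor_representable[OF r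
              4(2,3,5)]]])
      (use 4 r in \<open>simp_all add: Comp1_Obj Comp1_assoc Comp2_assoc[symmetric] Comp2_Ide Comp2_Arr
          Ide_Arr\<close>)
next
  case (5 a b c \<alpha> \<beta>)
  show ?case
    unfolding Cat_simps representable_simps(1)
  proof (rule nat_trans_eqI[OF nat_trans_representable
        nat_trans_hcomp[OF nat_trans_representable[OF r 5(1,2,4)] nat_trans_representable[OF r
            5(2,3,5)]]])
    note dca = Dom_Cod_Obj[OF 5(1,2,4)] and dcb = Dom_Cod_Obj[OF 5(2,3,5)]
    show "Src (F2 (representable D r) a c (Comp2 D a b c \<beta> \<alpha>)) =
      Src (hcomp (Hom2 D r a) (Hom2 D r c) (F2 (representable D r) b c \<beta>) (F2 (representable D r)
          a b \<alpha>))"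
      by (rule is_functor_eqI[OF nat_trans.axioms(1) nat_trans.axioms(1), OF nat_trans_representable
        nat_trans_hcomp[OF nat_trans_representable[OF r 5(1,2,4)] nat_trans_representable[OF r
            5(2,3,5)]]])
        (use 5 r dca dcb in \<open>simp_all add: representable_Src_Trg Comp1_Obj Comp1_assoc
            Comp2_assoc[symmetric] Comp2_Ide Comp2_Arr Ide_Arr\<close>)
    show "Trg (F2 (representable D r) a c (Comp2 D a b c \<beta> \<alpha>)) =
      Trg (hcomp (Hom2 D r a) (Hom2 D r c) (F2 (representable D r) b c \<beta>) (F2 (representable D r)
          a b \<alpha>))"
      by (rule is_functor_eqI[OF nat_trans.axioms(2) nat_trans.axioms(2), OF nat_trans_representable
        nat_trans_hcomp[OF nat_trans_representable[OF r 5(1,2,4)] nat_trans_representable[OF r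
            5(2,3,5)]]])
        (use 5 r dca dcb in \<open>simp_all add: representable_Src_Trg Comp1_Obj Comp1_assoc
            Comp2_assoc[symmetric] Comp2_Ide Comp2_Arr Ide_Arr\<close>)
    fix g assume g: "g \<in> Obj (Hom2 D r a)"
    \<comment> \<open>The component of the horizontal composite in \<open>Cat\<close> is a
      whiskering of \<beta> after a whiskering of \<alpha> g. Applying \<open>Comp2_whiskers\<close>
      to the 2-cell \<alpha> g, rather than to \<alpha>, merges them, and associativity moves g
      outside.\<close>
    note ag = Comp2_Hom[OF r 5(1,2) Ide_Hom2[OF r 5(1) g] Arr_in_Hom[OF 5(4)]]
    show "Cmp (F2 (representable D r) a c (Comp2 D a b c \<beta> \<alpha>)) g =
      Cmp (hcomp (Hom2 D r a) (Hom2 D r c) (F2 (representable D r) b c \<beta>) (F2 (representable D r)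
          a b \<alpha>)) g"
      using Comp2_whiskers(1)[OF r 5(2,3) ag Arr_in_Hom[OF 5(5)]] 5 r g dca dcb ag
      by (simp add: representable_Src_Trg Comp1_Obj Comp2_assoc Comp2_Arr Ide_Arr)
  qed (use 5 r in \<open>simp_all add: Comp2_Arr\<close>)
qed

end

section \<open>Locally discrete 2-categories\<close>

lemma disc_simps [simp]:
  "Obj0 (disc A) = Obj A"
  "Obj (Hom2 (disc A) a b) = Hom A a b"
  "Arr (Hom2 (disc A) a b) = Hom A a b"
  "Dom (Hom2 (disc A) a b) f = f"
  "Cod (Hom2 (disc A) a b) f = f"
  "Ide (Hom2 (disc A) a b) f = f"
  "g \<cdot>\<^bsub>Hom2 (disc A) a b\<^esub> f = f"
  "One (disc A) = Ide A"
  "Comp1 (disc A) a b c = Comp A"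
  "Comp2 (disc A) a b c = Comp A"
  by (simp_all add: disc_def)

lemma in_Hom_disc [simp]: "\<alpha> \<in> Hom (Hom2 (disc A) a b) f f' \<longleftrightarrow> \<alpha> \<in> Hom A a b \<and> f = \<alpha> \<and> f' = \<alpha>"
  by (auto simp: in_Hom_iff)

text \<open>Two cells of such a hom-category are composable only if they are equal, so returning the
  second argument is a lawful composition and interchange holds trivially.\<close>

lemma two_category_disc:
  assumes "category A"
  shows "two_category (disc A)"
proof -
  interpret category A by fact
  have "category (Hom2 (disc A) a b)" for a b
    by unfold_locales auto
  then show ?thesis
    by unfold_locales
      (auto simp: Ide_Hom Comp_Ide_left Comp_Ide_right intro: Comp_Hom Comp_assoc category.Comp_Hom)
qed

lemma disc_functor_simps [simp]:
  "F0 (disc_functor A F) = FO F"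
  "f \<in> Hom A a b \<Longrightarrow> F1 (disc_functor A F) a b f = FA F f"
  "f \<in> Hom A a b \<Longrightarrow> F2 (disc_functor A F) a b f = FA F f"
  by (simp_all add: disc_functor_def)

lemma two_functor_disc:
  assumes "is_functor A B F"
  shows "two_functor (disc A) (disc B) (disc_functor A F)"
proof -
  interpret is_functor A B F by fact
  interpret DA: two_category "disc A" by (rule two_category_disc) unfold_locales
  interpret DB: two_category "disc B" by (rule two_category_disc) unfold_locales
  show ?thesis
  proof (intro two_functor.intro DA.two_category_axioms DB.two_category_axioms
      two_functor_axioms.intro, goal_cases)
    case (2 a b)
    interpret hA: category "Hom2 (disc A) a b" using DA.category_Hom2 2 by blast
    interpret hB: category "Hom2 (disc B) (FO F a) (FO F b)"
      using DB.category_Hom2 FO_Obj 2 by simp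
    have "is_functor (Hom2 (disc A) a b) (Hom2 (disc B) (FO F a) (FO F b)) (F_hom (disc_functor A
        F) a b)"
      by unfold_locales (auto simp: FA_Hom, auto simp: disc_functor_def)
    then show ?case by simp
  next
    case (4 a b c f g)
    then have "f \<in> Hom A a b" "g \<in> Hom A b c" by auto
    then show ?case using FA_Comp A.Comp_Hom by simp
  next
    case (5 a b c f g)
    then have "f \<in> Hom A a b" "g \<in> Hom A b c" by auto
    then show ?case using FA_Comp A.Comp_Hom by simp
  qed (auto simp: FO_Obj A.Ide_Hom FA_Ide)
qed

text \<open>In \<open>disc B\<close> a 2-cell joins only equal arrows, so the typing condition
  \<open>Q2_Hom\<close> is exactly the naturality square. Vertical composition returns its second
  argument, which in the pasting axiom is the right whiskering; that axiom thus becomes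
  associativity together with functoriality of the source.\<close>

lemma quasi_natural_trans_nat_trans:
  assumes "nat_trans A B \<tau>"
  shows "quasi_natural_trans A B \<tau>"
proof -
  interpret nat_trans A B \<tau> by fact
  have Q2: "f \<in> Hom A a b \<Longrightarrow> Q2 (disc_trans A B \<tau>) (a, b, f) = Cmp \<tau> b \<cdot>\<^bsub>B\<^esub> FA (Src \<tau>) f" for a b f
    using S.A.Dom_Obj S.A.Cod_Obj by (auto simp: disc_trans_def cells1_def in_Hom_iff)
  have Q1: "Q1 (disc_trans A B \<tau>) = Cmp \<tau>" by (simp add: disc_trans_def)
  show ?thesis
    unfolding quasi_natural_trans_def
  proof (intro quasi_natural.intro two_functor_disc S.is_functor_axioms T.is_functor_axioms
      quasi_natural_axioms.intro, goal_cases)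
    case 1 show ?case by (simp add: disc_trans_def Cmp_ext)
  next
    case 2 show ?case by (simp add: disc_trans_def)
  next
    case (3 a) then show ?case by (simp add: Q1 Cmp_Hom)
  next
    case (4 a b f)
    then have "f \<in> Hom A a b" "b \<in> Obj A" by auto
    then show ?case using S.B.Comp_Hom[OF S.FA_Hom Cmp_Hom] by (simp add: Q1 Q2 naturality)
  next
    case (5 a) then show ?case
      using S.B.Comp_Ide_right[OF Cmp_Hom] by (simp add: Q1 Q2 S.A.Ide_Hom S.FA_Ide)
  next
    case (6 a b c f g)
    then have fg: "f \<in> Hom A a b" "g \<in> Hom A b c" "c \<in> Obj A" by auto
    then show ?case
      using S.B.Comp_assoc[OF S.FA_Hom[OF fg(1)] S.FA_Hom[OF fg(2)] Cmp_Hom[OF fg(3)]]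
          S.A.Comp_Hom[OF fg(1,2)]
      by (simp add: Q1 Q2 whisker_right_def S.FA_Comp)
  next
    case (7 a b \<alpha> f f') then show ?case by (auto simp: Q1 Q2 whisker_left_def)
  qed
qed

section \<open>Evaluation at the identity and its right adjoint\<close>

locale cat_valued = K: two_functor D Cat K
  for D :: "('c, 'o, 'm) two_cat"
    and K :: "('c, 'o, 'm, ('o, 'm) cat, ('o, 'm, 'o, 'm) fctr, ('o, 'm, 'o, 'm) ntr) two_fctr" +
  fixes r :: 'c
  assumes r: "r \<in> Obj0 D"
begin

abbreviation R where "R \<equiv> representable D r"

abbreviation Q where "Q \<equiv> qNat D Cat R K"

section \<open>Componentwise form of the 2-functor, transformation and modification axioms\<close>

lemma category_K: "a \<in> Obj0 D \<Longrightarrow> category (F0 K a)"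
  using K.F0_Obj0 by simp

lemma is_functor_K:
  "a \<in> Obj0 D \<Longrightarrow> b \<in> Obj0 D \<Longrightarrow> f \<in> Obj (Hom2 D a b) \<Longrightarrow> is_functor (F0 K a) (F0 K b) (F1 K a b f)"
  using K.F1_Obj by (simp add: functor_cat_simps)

lemma nat_trans_K:
  assumes "a \<in> Obj0 D" "b \<in> Obj0 D" "\<alpha> \<in> Hom (Hom2 D a b) f f'"
  shows "nat_trans (F0 K a) (F0 K b) (F2 K a b \<alpha>)"
    "Src (F2 K a b \<alpha>) = F1 K a b f" "Trg (F2 K a b \<alpha>) = F1 K a b f'"
  using K.F2_Hom[OF assms] by (simp_all add: in_Hom_functor_cat)

lemma K_One: "a \<in> Obj0 D \<Longrightarrow> F1 K a a (One D a) = id_functor (F0 K a)"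
  using K.F1_One by simp

lemma K_Comp1:
  "\<lbrakk>a \<in> Obj0 D; b \<in> Obj0 D; c \<in> Obj0 D; f \<in> Obj (Hom2 D a b); g \<in> Obj (Hom2 D b c)\<rbrakk> \<Longrightarrow>
    F1 K a c (Comp1 D a b c g f) = comp_functor (F0 K a) (F1 K b c g) (F1 K a b f)"
  using K.F1_Comp1 by simp

text \<open>The 2-functor \<open>K\<close> carries whiskering in \<open>D\<close> to whiskering in
  \<open>Cat\<close>, which \<open>hcomp_Ide_right\<close> evaluates. This trades a 2-cell out of
  \<open>a\<close>, evaluated at U, for one out of \<open>b\<close>, evaluated at K(f)(U).\<close>

lemma K_whisker_right:
  assumes "a \<in> Obj0 D" "b \<in> Obj0 D" "c \<in> Obj0 D" "f \<in> Obj (Hom2 D a b)" "\<beta> \<in> Hom (Hom2 D b c) g g'"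
    and "U \<in> Obj (F0 K a)"
  shows "Cmp (F2 K a c (Comp2 D a b c \<beta> (Ide (Hom2 D a b) f))) U = Cmp (F2 K b c \<beta>) (FO (F1 K a b
      f) U)"
proof -
  have "F2 K a c (Comp2 D a b c \<beta> (Ide (Hom2 D a b) f))
      = hcomp (F0 K a) (F0 K c) (F2 K b c \<beta>) (Ide (functor_cat (F0 K a) (F0 K b)) (F1 K a b f))"
    using K.F2_Comp2[OF assms(1-3) K.D.Ide_Arr(1)[OF assms(1,2,4)]] assms(5) K.F2_Ide[OF
        assms(1,2,4)]
    by (simp add: in_Hom_iff)
  then show ?thesis
    by (simp add: hcomp_Ide_right[OF nat_trans_K(1)[OF assms(2,3,5)] is_functor_K[OF assms(1,2,4)]
        assms(6)])
qed

text \<open>The counterpart through \<open>hcomp_Ide_left\<close>; it supplies the 2-cell half of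
  the strictness of \<open>\<Psi>hat_obj\<close>.\<close>

lemma K_whisker_left:
  assumes "a \<in> Obj0 D" "b \<in> Obj0 D" "c \<in> Obj0 D" "\<alpha> \<in> Hom (Hom2 D a b) f f'" "g \<in> Obj (Hom2 D b c)"
    and "U \<in> Obj (F0 K a)"
  shows "Cmp (F2 K a c (Comp2 D a b c (Ide (Hom2 D b c) g) \<alpha>)) U = FA (F1 K b c g) (Cmp (F2 K a b
      \<alpha>) U)"
proof -
  have "F2 K a c (Comp2 D a b c (Ide (Hom2 D b c) g) \<alpha>)
      = hcomp (F0 K a) (F0 K c) (Ide (functor_cat (F0 K b) (F0 K c)) (F1 K b c g)) (F2 K a b \<alpha>)"
    using K.F2_Comp2[OF assms(1-3) _ K.D.Ide_Arr(1)[OF assms(2,3,5)]] assms(4) K.F2_Ide[OF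
        assms(2,3,5)]
    by (simp add: in_Hom_iff)
  then show ?thesis
    by (simp add: hcomp_Ide_left[OF nat_trans_K(1)[OF assms(1,2,4)] is_functor_K[OF assms(2,3,5)]
        assms(6)])
qed

lemma quasi_natural_Q1:
  assumes "quasi_natural D Cat R K \<sigma>" "a \<in> Obj0 D"
  shows "is_functor (Hom2 D r a) (F0 K a) (Q1 \<sigma> a)"
  using quasi_natural.Q1_Obj[OF assms] by (simp add: functor_cat_simps)

lemma quasi_natural_Q2:
  assumes "quasi_natural D Cat R K \<sigma>" "a \<in> Obj0 D" "b \<in> Obj0 D" "f \<in> Obj (Hom2 D a b)"
  shows "nat_trans (Hom2 D r a) (F0 K b) (Q2 \<sigma> (a, b, f))"
    and "Src (Q2 \<sigma> (a, b, f)) = comp_functor (Hom2 D r a) (Q1 \<sigma> b) (F1 R a b f)"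
    and "Trg (Q2 \<sigma> (a, b, f)) = comp_functor (Hom2 D r a) (F1 K a b f) (Q1 \<sigma> a)"
  using quasi_natural.Q2_Hom[OF assms] by (simp_all add: in_Hom_functor_cat)

lemma Cmp_Q2_Hom:
  assumes "quasi_natural D Cat R K \<sigma>" "a \<in> Obj0 D" "b \<in> Obj0 D" "f \<in> Obj (Hom2 D a b)"
    and "g \<in> Obj (Hom2 D r a)"
  shows "Cmp (Q2 \<sigma> (a, b, f)) g
    \<in> Hom (F0 K b) (FO (Q1 \<sigma> b) (Comp1 D r a b f g)) (FO (F1 K a b f) (FO (Q1 \<sigma> a) g))"
  using nat_trans.Cmp_Hom[OF quasi_natural_Q2(1)[OF assms(1-4)] assms(5)] quasi_natural_Q2[OF
      assms(1-4)] assms(4,5)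
  by simp

lemma Cmp_Q2_One:
  assumes "quasi_natural D Cat R K \<sigma>" "a \<in> Obj0 D" "g \<in> Obj (Hom2 D r a)"
  shows "Cmp (Q2 \<sigma> (a, a, One D a)) g = Ide (F0 K a) (FO (Q1 \<sigma> a) g)"
  using quasi_natural.Q2_One[OF assms(1,2)] assms(3) by (simp add: functor_cat_simps)

text \<open>With \<open>r\<close> as first 0-cell and \<open>x = One D r\<close>, this pasting law
  expresses the unit at a composite 1-cell through the unit at its first factor and a 2-cell of
  \<sigma>.\<close>

lemma Cmp_Q2_Comp1:
  assumes "quasi_natural D Cat R K \<sigma>" "a \<in> Obj0 D" "b \<in> Obj0 D" "c \<in> Obj0 D"
    and "f \<in> Obj (Hom2 D a b)" "g \<in> Obj (Hom2 D b c)" "x \<in> Obj (Hom2 D r a)"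
  shows "Cmp (Q2 \<sigma> (a, c, Comp1 D a b c g f)) x
    = FA (F1 K b c g) (Cmp (Q2 \<sigma> (a, b, f)) x) \<cdot>\<^bsub>F0 K c\<^esub> Cmp (Q2 \<sigma> (b, c, g)) (Comp1 D r a b f x)"
  using quasi_natural.Q2_Comp1[OF assms(1-6)] assms(5,7)
    hcomp_Ide_left[OF quasi_natural_Q2(1)[OF assms(1-3,5)] is_functor_K[OF assms(3,4,6)] assms(7)]
    hcomp_Ide_right[OF quasi_natural_Q2(1)[OF assms(1,3,4,6)]
      K.D.is_functor_representable[OF r assms(2,3,5)] assms(7)]
  by (simp add: whisker_left_def whisker_right_def functor_cat_simps(6))

lemma Cmp_Q2_natural:
  assumes "quasi_natural D Cat R K \<sigma>" "a \<in> Obj0 D" "b \<in> Obj0 D" "\<alpha> \<in> Hom (Hom2 D a b) f f'"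
    and "g \<in> Obj (Hom2 D r a)"
  shows "Cmp (F2 K a b \<alpha>) (FO (Q1 \<sigma> a) g) \<cdot>\<^bsub>F0 K b\<^esub> Cmp (Q2 \<sigma> (a, b, f)) g
    = Cmp (Q2 \<sigma> (a, b, f')) g \<cdot>\<^bsub>F0 K b\<^esub> FA (Q1 \<sigma> b) (Comp2 D r a b \<alpha> (Ide (Hom2 D r a) g))"
proof -
  have al: "\<alpha> \<in> Arr (Hom2 D a b)" using assms(4) by (simp add: in_Hom_iff)
  show ?thesis
    using arg_cong[OF quasi_natural.Q2_natural[OF assms(1-4)], of "\<lambda>\<tau>. Cmp \<tau> g"] al assms(5)
      hcomp_Ide_right[OF nat_trans_K(1)[OF assms(2-4)] quasi_natural_Q1[OF assms(1,2)] assms(5)]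
      hcomp_Ide_left[OF K.D.nat_trans_representable[OF r assms(2,3) al] quasi_natural_Q1[OF
          assms(1,3)] assms(5)]
    by (simp add: whisker_left_def whisker_right_def functor_cat_simps(6))
qed

lemma modification_MCmp:
  assumes "modification D Cat R K \<Sigma>" "a \<in> Obj0 D"
  shows "nat_trans (Hom2 D r a) (F0 K a) (MCmp \<Sigma> a)"
    and "Src (MCmp \<Sigma> a) = Q1 (MSrc \<Sigma>) a" "Trg (MCmp \<Sigma> a) = Q1 (MTrg \<Sigma>) a"
  using modification.MCmp_Hom[OF assms] by (simp_all add: in_Hom_functor_cat)

lemma Cmp_MCmp_Hom:
  assumes "modification D Cat R K \<Sigma>" "a \<in> Obj0 D" "f \<in> Obj (Hom2 D r a)"
  shows "Cmp (MCmp \<Sigma> a) f \<in> Hom (F0 K a) (FO (Q1 (MSrc \<Sigma>) a) f) (FO (Q1 (MTrg \<Sigma>) a) f)"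
  using nat_trans.Cmp_Hom[OF modification_MCmp(1)[OF assms(1,2)] assms(3)] modification_MCmp[OF
      assms(1,2)]
  by simp

text \<open>The modification axiom at the identity 2-cell of f, where the horizontal composites
  shrink to whiskerings and can be evaluated at g.\<close>

lemma Cmp_MCmp_natural:
  assumes "modification D Cat R K \<Sigma>" "a \<in> Obj0 D" "b \<in> Obj0 D" "f \<in> Obj (Hom2 D a b)"
    and "g \<in> Obj (Hom2 D r a)"
  shows "Cmp (Q2 (MTrg \<Sigma>) (a, b, f)) g \<cdot>\<^bsub>F0 K b\<^esub> Cmp (MCmp \<Sigma> b) (Comp1 D r a b f g)
    = FA (F1 K a b f) (Cmp (MCmp \<Sigma> a) g) \<cdot>\<^bsub>F0 K b\<^esub> Cmp (Q2 (MSrc \<Sigma>) (a, b, f)) g"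
proof -
  interpret R: two_functor D Cat R by (rule K.D.two_functor_representable[OF r])
  show ?thesis
    using arg_cong[OF modification.MCmp_natural[OF assms(1-3) K.D.Ide_Hom2[OF assms(2-4)]], of
        "\<lambda>\<tau>. Cmp \<tau> g"]
      assms(4,5) R.F2_Ide[OF assms(2-4)] K.F2_Ide[OF assms(2-4)]
      hcomp_Ide_right[OF modification_MCmp(1)[OF assms(1,3)] K.D.is_functor_representable[OF r
          assms(2-4)] assms(5)]
      hcomp_Ide_left[OF modification_MCmp(1)[OF assms(1,2)] is_functor_K[OF assms(2-4)] assms(5)]
    by (simp add: functor_cat_simps(6))
qed

lemma quasi_natural_MSrc_MTrg:
  assumes "modification D Cat R K \<Sigma>"
  shows "quasi_natural D Cat R K (MSrc \<Sigma>)" "quasi_natural D Cat R K (MTrg \<Sigma>)"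
  using assms by (simp_all add: modification_def)

section \<open>The evaluation functor\<close>

lemma is_functor_\<Psi>: "is_functor Q (F0 K r) (\<Psi> D K r)"
proof -
  interpret Q: category Q by (rule category_qNat)
  interpret Kr: category "F0 K r" by (rule category_K[OF r])
  note One = K.D.One_Obj[OF r]
  show ?thesis
  proof (unfold_locales, goal_cases)
    case 1 show ?case by (simp add: \<Psi>_def)
  next
    case 2 show ?case by (simp add: \<Psi>_def)
  next
    case (3 \<sigma>) then show ?case
      using is_functor.FO_Obj[OF quasi_natural_Q1[OF _ r] One] by (simp add: \<Psi>_def qNat_simps)
  next
    case (4 \<Sigma> \<sigma> \<tau>) then show ?case
      using Cmp_MCmp_Hom[OF _ r One, of \<Sigma>] quasi_natural_MSrc_MTrg[of \<Sigma>]
      by (auto simp: \<Psi>_def in_Hom_qNat qNat_simps)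
  next
    case (5 \<sigma>) then show ?case
      using modification_Ide[of D Cat R K \<sigma>] One r by (simp add: \<Psi>_def qNat_simps functor_cat_simps)
  next
    case (6 \<Sigma> \<sigma> \<tau> \<Sigma>' \<rho>)
    then have "\<Sigma> \<in> Arr Q" "\<Sigma>' \<in> Arr Q" "\<Sigma>' \<cdot>\<^bsub>Q\<^esub> \<Sigma> \<in> Arr Q" using Q.Comp_Hom[OF 6] by (auto simp:
        in_Hom_iff)
    moreover have "MCmp (\<Sigma>' \<cdot>\<^bsub>Q\<^esub> \<Sigma>) r = MCmp \<Sigma>' r \<cdot>\<^bsub>functor_cat (Hom2 D r r) (F0 K r)\<^esub> MCmp \<Sigma> r"
      using r by (simp add: qNat_simps)
    ultimately show ?case
      using One by (simp add: \<Psi>_def functor_cat_simps)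
  qed
qed

section \<open>The strict transformation attached to an object of K(r)\<close>

lemma \<Psi>hat_obj_Q1 [simp]:
  "d \<in> Obj0 D \<Longrightarrow> f \<in> Obj (Hom2 D r d) \<Longrightarrow> FO (Q1 (\<Psi>hat_obj D K r U) d) f = FO (F1 K r d f) U"
  "d \<in> Obj0 D \<Longrightarrow> \<alpha> \<in> Arr (Hom2 D r d) \<Longrightarrow> FA (Q1 (\<Psi>hat_obj D K r U) d) \<alpha> = Cmp (F2 K r d \<alpha>) U"
  by (simp_all add: \<Psi>hat_obj_def Let_def)

lemma \<Psi>hat_obj_Q2:
  assumes "a \<in> Obj0 D" "b \<in> Obj0 D" "f \<in> Obj (Hom2 D a b)"
  shows "Q2 (\<Psi>hat_obj D K r U) (a, b, f) = Ide (functor_cat (Hom2 D r a) (F0 K b))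
    (comp_functor (Hom2 D r a) (Q1 (\<Psi>hat_obj D K r U) b) (F1 R a b f))"
  using assms by (simp add: \<Psi>hat_obj_def Let_def cells1_def)

text \<open>This is \<open>F_hom K r d\<close> followed by evaluation at U. The laws are inherited
  because identities and vertical composites of natural transformations are formed
  pointwise.\<close>

lemma is_functor_\<Psi>hat_obj:
  assumes U: "U \<in> Obj (F0 K r)" and d: "d \<in> Obj0 D"
  shows "is_functor (Hom2 D r d) (F0 K d) (Q1 (\<Psi>hat_obj D K r U) d)"
proof -
  interpret rd: category "Hom2 D r d" by (rule K.D.category_Hom2[OF r d])
  interpret Kd: category "F0 K d" by (rule category_K[OF d])
  show ?thesis
  proof (unfold_locales, goal_cases)
    case 1 show ?case using d by (simp add: \<Psi>hat_obj_def Let_def)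
  next
    case 2 show ?case using d by (simp add: \<Psi>hat_obj_def Let_def)
  next
    case (3 f) then show ?case using is_functor.FO_Obj[OF is_functor_K[OF r d 3] U] d by simp
  next
    case (4 \<alpha> f f')
    then show ?case
      using nat_trans.Cmp_Hom[OF nat_trans_K(1)[OF r d 4] U] nat_trans_K(2,3)[OF r d 4] d
        K.D.Dom_Cod_Hom2[OF r d 4] by (simp add: in_Hom_iff)
  next
    case (5 f) then show ?case
      using K.F2_Ide[OF r d 5] K.D.Ide_Arr[OF r d 5] d U by (simp add: functor_cat_simps)
  next
    case (6 \<alpha> f f' \<alpha>' f'')
    then have "\<alpha> \<in> Arr (Hom2 D r d)" "\<alpha>' \<in> Arr (Hom2 D r d)" "\<alpha>' \<cdot>\<^bsub>Hom2 D r d\<^esub> \<alpha> \<in> Arr (Hom2 D r d)"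
      using rd.Comp_Hom[OF 6] by (auto simp: in_Hom_iff)
    then show ?case
      using is_functor.FA_Comp[OF K.F_hom_functor[OF r d] 6] d U by (simp add: functor_cat_simps)
  qed
qed

text \<open>On 1-cells this is K(f g)(U) = K(f)(K(g)(U)), on 2-cells \<open>K_whisker_left\<close>.
  Only this equality of functors allows an identity to have the source and the target prescribed for
  a 2-cell of a quasi-natural transformation.\<close>

lemma \<Psi>hat_obj_strict:
  assumes U: "U \<in> Obj (F0 K r)" and ab: "a \<in> Obj0 D" "b \<in> Obj0 D" and f: "f \<in> Obj (Hom2 D a b)"
  shows "comp_functor (Hom2 D r a) (Q1 (\<Psi>hat_obj D K r U) b) (F1 R a b f)
    = comp_functor (Hom2 D r a) (F1 K a b f) (Q1 (\<Psi>hat_obj D K r U) a)"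
proof (rule is_functor_eqI[OF is_functor_comp[OF K.D.is_functor_representable[OF r ab f]
    is_functor_\<Psi>hat_obj[OF U ab(2)]]
      is_functor_comp[OF is_functor_\<Psi>hat_obj[OF U ab(1)] is_functor_K[OF ab f]]])
  fix g assume "g \<in> Obj (Hom2 D r a)"
  then show "FO (comp_functor (Hom2 D r a) (Q1 (\<Psi>hat_obj D K r U) b) (F1 R a b f)) g
      = FO (comp_functor (Hom2 D r a) (F1 K a b f) (Q1 (\<Psi>hat_obj D K r U) a)) g"
    using U ab f r by (simp add: K.D.Comp1_Obj K_Comp1)
next
  fix \<gamma> assume "\<gamma> \<in> Arr (Hom2 D r a)"
  then show "FA (comp_functor (Hom2 D r a) (Q1 (\<Psi>hat_obj D K r U) b) (F1 R a b f)) \<gamma>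
      = FA (comp_functor (Hom2 D r a) (F1 K a b f) (Q1 (\<Psi>hat_obj D K r U) a)) \<gamma>"
    using K_whisker_left[OF r ab Arr_in_Hom f U] U ab f r K.D.Comp2_Arr K.D.Ide_Arr by simp
qed simp_all

lemma quasi_natural_\<Psi>hat_obj:
  assumes U: "U \<in> Obj (F0 K r)"
  shows "quasi_natural D Cat R K (\<Psi>hat_obj D K r U)"
proof (intro quasi_natural.intro K.D.two_functor_representable[OF r] K.two_functor_axioms
    quasi_natural_axioms.intro, goal_cases)
  case 1 show ?case by (simp add: \<Psi>hat_obj_def Let_def)
next
  case 2 show ?case by (simp add: \<Psi>hat_obj_def Let_def)
next
  case (3 a) then show ?case using is_functor_\<Psi>hat_obj[OF U] by (simp add: functor_cat_simps)
next
  case (4 a b f)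
  note c = is_functor_comp[OF K.D.is_functor_representable[OF r 4] is_functor_\<Psi>hat_obj[OF U 4(2)]]
  show ?case
    using category.Ide_Hom[OF category_functor_cat[OF category_K[OF 4(2)], of "Hom2 D r a"]] c
        \<Psi>hat_obj_strict[OF U 4]
    by (simp add: \<Psi>hat_obj_Q2[OF 4] functor_cat_simps(1))
next
  case (5 a)
  note i = K.D.One_Obj[OF 5]
  show ?case
    using \<Psi>hat_obj_strict[OF U 5 5 i] comp_functor_id(1)[OF is_functor_\<Psi>hat_obj[OF U 5]]
    by (simp add: \<Psi>hat_obj_Q2[OF 5 5 i] K_One[OF 5])
next
  case (6 a b c f g)
  note gf = K.D.Comp1_Obj[OF 6]
  note Rf = K.D.is_functor_representable[OF r 6(1,2,4)] and Rg = K.D.is_functor_representable[OF r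
      6(2,3,5)]
  note s = is_functor_\<Psi>hat_obj[OF U]
  let ?\<sigma> = "\<Psi>hat_obj D K r U" and ?A = "Hom2 D r a"
  \<comment> \<open>\<open>?F\<close> is the common boundary of the pasting: both whiskered
    identities turn out to be the identity of \<open>?F\<close>, the left one after strictness at g
    replaces K(g) after \<sigma>_b by \<sigma>_c after the action of g.\<close>
  let ?F = "comp_functor ?A (comp_functor (Hom2 D r b) (Q1 ?\<sigma> c) (F1 R b c g)) (F1 R a b f)"
  interpret R: two_functor D Cat R by (rule K.D.two_functor_representable[OF r])
  interpret AC: category "functor_cat ?A (F0 K c)" by (rule category_functor_cat[OF category_K[OF
      6(3)]])
  have O: "category ?A" "category (Hom2 D r b)" "category (F0 K b)" "category (F0 K c)"
    using 6 r by (simp_all add: category_K K.D.category_Hom2)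
  have F: "is_functor ?A (F0 K c) ?F" by (intro is_functor_comp[OF Rf] is_functor_comp[OF Rg] s 6)
  have "hcomp ?A (F0 K c) (Ide (functor_cat (F0 K b) (F0 K c)) (F1 K b c g))
      (Ide (functor_cat ?A (F0 K b)) (comp_functor ?A (Q1 ?\<sigma> b) (F1 R a b f)))
    = Ide (functor_cat ?A (F0 K c)) (comp_functor ?A (F1 K b c g) (comp_functor ?A (Q1 ?\<sigma> b) (F1 R
        a b f)))"
    using K.E.Comp2_Ide[of ?A "F0 K b" "F0 K c"] O is_functor_comp[OF Rf s[OF 6(2)]]
        is_functor_K[OF 6(2,3,5)]
    by (simp add: functor_cat_simps(1))
  also have "comp_functor ?A (F1 K b c g) (comp_functor ?A (Q1 ?\<sigma> b) (F1 R a b f)) = ?F"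
    using comp_functor_assoc[OF Rf, symmetric] \<Psi>hat_obj_strict[OF U 6(2,3,5)] by simp
  finally have 1: "hcomp ?A (F0 K c) (Ide (functor_cat (F0 K b) (F0 K c)) (F1 K b c g))
      (Ide (functor_cat ?A (F0 K b)) (comp_functor ?A (Q1 ?\<sigma> b) (F1 R a b f))) = Ide (functor_cat
          ?A (F0 K c)) ?F" .
  have 2: "hcomp ?A (F0 K c) (Ide (functor_cat (Hom2 D r b) (F0 K c)) (comp_functor (Hom2 D r b)
      (Q1 ?\<sigma> c) (F1 R b c g)))
      (Ide (functor_cat ?A (Hom2 D r b)) (F1 R a b f)) = Ide (functor_cat ?A (F0 K c)) ?F"
    using K.E.Comp2_Ide[of ?A "Hom2 D r b" "F0 K c"] O is_functor_comp[OF Rg s[OF 6(3)]] Rf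
    by (simp add: functor_cat_simps(1))
  have "comp_functor ?A (Q1 ?\<sigma> c) (F1 R a c (Comp1 D a b c g f)) = ?F"
    using R.F1_Comp1[OF 6] by (simp add: comp_functor_assoc[OF Rf])
  then show ?case
    using 1 2 AC.Comp_Ide_left[OF AC.Ide_Hom, of ?F] F
    by (simp add: \<Psi>hat_obj_Q2 6 gf whisker_left_def whisker_right_def functor_cat_simps(1))
next
  case (7 a b \<alpha> f f')
  let ?\<sigma> = "\<Psi>hat_obj D K r U" and ?A = "Hom2 D r a"
  note ff' = K.D.Dom_Cod_Hom2[OF 7]
  interpret AB: category "functor_cat ?A (F0 K b)" by (rule category_functor_cat[OF category_K[OF
      7(2)]])
  have al: "\<alpha> \<in> Arr (Hom2 D a b)" "Dom (Hom2 D a b) \<alpha> = f" "Cod (Hom2 D a b) \<alpha> = f'"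
    using 7(3) by (auto simp: in_Hom_iff)
  note Ral = K.D.nat_trans_representable[OF r 7(1,2) al(1)]
  note Rst = K.D.representable_Src_Trg[OF 7(1,2) al(1), of r, unfolded al]
  note s = is_functor_\<Psi>hat_obj[OF U]
  let ?l = "hcomp ?A (F0 K b) (F2 K a b \<alpha>) (Ide (functor_cat ?A (F0 K a)) (Q1 ?\<sigma> a))"
  let ?r = "hcomp ?A (F0 K b) (Ide (functor_cat (Hom2 D r b) (F0 K b)) (Q1 ?\<sigma> b)) (F2 R a b \<alpha>)"
  have nl: "nat_trans ?A (F0 K b) ?l"
    by (rule nat_trans_hcomp[OF nat_trans_Ide[OF s[OF 7(1)]] nat_trans_K(1)[OF 7]])
  have nr: "nat_trans ?A (F0 K b) ?r"
    by (rule nat_trans_hcomp[OF Ral nat_trans_Ide[OF s[OF 7(2)]]])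
  \<comment> \<open>With identity 2-cells, the axiom asks that the two whiskerings of \<alpha>
    agree. At g both are the component of K(\<alpha>) at K(g)(U), by
    \<open>K_whisker_right\<close>.\<close>
  have lr: "?l = ?r"
  proof (rule nat_trans_eqI[OF nl nr])
    show "Src ?l = Src ?r" "Trg ?l = Trg ?r"
      using \<Psi>hat_obj_strict[OF U 7(1,2)] ff' nat_trans_K(2,3)[OF 7] Rst by (simp_all add:
          functor_cat_simps)
    fix g assume g: "g \<in> Obj ?A"
    show "Cmp ?l g = Cmp ?r g"
      using hcomp_Ide_right[OF nat_trans_K(1)[OF 7] s[OF 7(1)] g] hcomp_Ide_left[OF Ral s[OF 7(2)]
          g]
        K_whisker_right[OF r 7(1,2) g 7(3) U] g al 7(1,2) r K.D.Comp2_Arr K.D.Ide_Arr by simp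
  qed
  have "?l \<in> Hom (functor_cat ?A (F0 K b)) (comp_functor ?A (F1 K a b f) (Q1 ?\<sigma> a))
      (comp_functor ?A (F1 K a b f') (Q1 ?\<sigma> a))"
    using nl nat_trans_K(2,3)[OF 7] by (simp add: in_Hom_functor_cat functor_cat_simps(5))
  then show ?case
    using lr AB.Comp_Ide_left AB.Comp_Ide_right
    by (simp add: \<Psi>hat_obj_Q2 ff' 7(1,2) whisker_left_def whisker_right_def \<Psi>hat_obj_strict[OF U
        7(1,2)])
qed

section \<open>The modification attached to an arrow of K(r)\<close>

lemma \<Psi>hat_arr_simps [simp]:
  "MSrc (\<Psi>hat_arr D K r t) = \<Psi>hat_obj D K r (Dom (F0 K r) t)"
  "MTrg (\<Psi>hat_arr D K r t) = \<Psi>hat_obj D K r (Cod (F0 K r) t)"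
  "d \<in> Obj0 D \<Longrightarrow> Src (MCmp (\<Psi>hat_arr D K r t) d) = Q1 (\<Psi>hat_obj D K r (Dom (F0 K r) t)) d"
  "d \<in> Obj0 D \<Longrightarrow> Trg (MCmp (\<Psi>hat_arr D K r t) d) = Q1 (\<Psi>hat_obj D K r (Cod (F0 K r) t)) d"
  "d \<in> Obj0 D \<Longrightarrow> f \<in> Obj (Hom2 D r d) \<Longrightarrow> Cmp (MCmp (\<Psi>hat_arr D K r t) d) f = FA (F1 K r d f) t"
  by (simp_all add: \<Psi>hat_arr_def Let_def)

text \<open>Naturality in f is the naturality square of the transformation K(\<alpha>) at the arrow
  t, read with the roles of \<alpha> and t exchanged.\<close>

lemma nat_trans_\<Psi>hat_arr:
  assumes t: "t \<in> Hom (F0 K r) U V" and d: "d \<in> Obj0 D"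
  shows "nat_trans (Hom2 D r d) (F0 K d) (MCmp (\<Psi>hat_arr D K r t) d)"
proof -
  interpret Kr: category "F0 K r" by (rule category_K[OF r])
  have UV: "U \<in> Obj (F0 K r)" "V \<in> Obj (F0 K r)" "Dom (F0 K r) t = U" "Cod (F0 K r) t = V"
    using t Kr.Dom_Obj Kr.Cod_Obj by (auto simp: in_Hom_iff)
  show ?thesis
  proof (intro nat_trans.intro, goal_cases)
    case 1 show ?case using is_functor_\<Psi>hat_obj d UV by simp
  next
    case 2 show ?case using is_functor_\<Psi>hat_obj d UV by simp
  next
    case 3 show ?case
    proof (unfold_locales, goal_cases)
      case 1 show ?case using d by (simp add: \<Psi>hat_arr_def Let_def)
    next
      case (2 f) then show ?case
        using is_functor.FA_Hom[OF is_functor_K[OF r d 2] t] d UV by simp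
    next
      case (3 \<alpha> f f')
      note ff' = K.D.Dom_Cod_Hom2[OF r d 3]
      have "\<alpha> \<in> Arr (Hom2 D r d)" using 3 by (simp add: in_Hom_iff)
      then show ?case
        using nat_trans.naturality[OF nat_trans_K(1)[OF r d 3] t] nat_trans_K(2,3)[OF r d 3] d UV
            ff' by simp
    qed
  qed
qed

text \<open>Source and target have identity 2-cells, so the axiom compares two horizontal
  composites. At g they are the two sides of the naturality square at t for the image under
  \<open>K\<close> of \<alpha> whiskered with g; \<open>K_whisker_right\<close> and
  \<open>K_Comp1\<close> then bring one side to the required form.\<close>

lemma modification_\<Psi>hat_arr:
  assumes t: "t \<in> Hom (F0 K r) U V"
  shows "modification D Cat R K (\<Psi>hat_arr D K r t)"
proof -
  interpret Kr: category "F0 K r" by (rule category_K[OF r])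
  have UV: "U \<in> Obj (F0 K r)" "V \<in> Obj (F0 K r)" "Dom (F0 K r) t = U" "Cod (F0 K r) t = V"
    using t Kr.Dom_Obj Kr.Cod_Obj by (auto simp: in_Hom_iff)
  show ?thesis
  proof (intro modification.intro, goal_cases)
    case 3 show ?case
    proof (intro modification_axioms.intro, goal_cases)
      case 1 show ?case by (simp add: \<Psi>hat_arr_def Let_def)
    next
      case (2 a) then show ?case using nat_trans_\<Psi>hat_arr[OF t] UV by (simp add: in_Hom_functor_cat)
    next
      case (3 a b \<alpha> f f')
      let ?\<sigma> = "\<Psi>hat_obj D K r U" and ?\<tau> = "\<Psi>hat_obj D K r V" and ?\<Sigma> = "\<Psi>hat_arr D K r t"
      let ?A = "Hom2 D r a"
      note ff' = K.D.Dom_Cod_Hom2[OF 3]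
      interpret AB: category "functor_cat ?A (F0 K b)" by (rule category_functor_cat[OF
          category_K[OF 3(2)]])
      have al: "\<alpha> \<in> Arr (Hom2 D a b)" "Dom (Hom2 D a b) \<alpha> = f" "Cod (Hom2 D a b) \<alpha> = f'"
        using 3(3) by (auto simp: in_Hom_iff)
      note Ral = K.D.nat_trans_representable[OF r 3(1,2) al(1)]
      note Rst = K.D.representable_Src_Trg[OF 3(1,2) al(1), of r, unfolded al]
      let ?l = "hcomp ?A (F0 K b) (MCmp ?\<Sigma> b) (F2 R a b \<alpha>)"
      let ?r = "hcomp ?A (F0 K b) (F2 K a b \<alpha>) (MCmp ?\<Sigma> a)"
      have nl: "nat_trans ?A (F0 K b) ?l"
        by (rule nat_trans_hcomp[OF Ral nat_trans_\<Psi>hat_arr[OF t 3(2)]])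
      have nr: "nat_trans ?A (F0 K b) ?r"
        by (rule nat_trans_hcomp[OF nat_trans_\<Psi>hat_arr[OF t 3(1)] nat_trans_K(1)[OF 3]])
      have lr: "?l = ?r"
      proof (rule nat_trans_eqI[OF nl nr])
        show "Src ?l = Src ?r" "Trg ?l = Trg ?r"
          using \<Psi>hat_obj_strict[OF UV(1) 3(1,2)] \<Psi>hat_obj_strict[OF UV(2) 3(1,2)] ff'
              nat_trans_K(2,3)[OF 3] Rst UV 3
          by simp_all
        fix g assume g: "g \<in> Obj ?A"
        note ag = K.D.Comp2_Hom[OF r 3(1,2) K.D.Ide_Hom2[OF r 3(1) g] 3(3)]
        have fg: "Comp1 D r a b f g \<in> Obj (Hom2 D r b)" "Comp1 D r a b f' g \<in> Obj (Hom2 D r b)"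
          using K.D.Dom_Cod_Hom2[OF r 3(2) ag] by auto
        have "Cmp ?l g = FA (F1 K r b (Comp1 D r a b f' g)) t \<cdot>\<^bsub>F0 K b\<^esub>
            Cmp (F2 K r b (Comp2 D r a b \<alpha> (Ide ?A g))) U"
          using g al Rst ff' UV 3(1,2) r fg ag by (simp add: in_Hom_iff)
        also have "\<dots> = Cmp (F2 K r b (Comp2 D r a b \<alpha> (Ide ?A g))) V \<cdot>\<^bsub>F0 K b\<^esub>
            FA (F1 K r b (Comp1 D r a b f g)) t"
          using nat_trans.naturality[OF nat_trans_K(1)[OF r 3(2) ag] t] nat_trans_K(2,3)[OF r 3(2)
              ag] by simp
        also have "\<dots> = Cmp ?r g"
          using K_whisker_right[OF r 3(1,2) g 3(3) UV(2)] K_Comp1[OF r 3(1,2) g ff'(1)] t g UV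
              3(1,2)
            nat_trans_K(2)[OF 3] by (simp add: in_Hom_iff)
        finally show "Cmp ?l g = Cmp ?r g" .
      qed
      have "?l \<in> Hom (functor_cat ?A (F0 K b)) (comp_functor ?A (Q1 ?\<sigma> b) (F1 R a b f))
          (comp_functor ?A (Q1 ?\<tau> b) (F1 R a b f'))"
        using nl Rst UV 3(2) by (simp add: in_Hom_functor_cat)
      then show ?case
        using lr AB.Comp_Ide_left AB.Comp_Ide_right UV
        by (simp add: \<Psi>hat_obj_Q2 ff' 3(1,2))
    qed
  qed (use UV quasi_natural_\<Psi>hat_obj in simp_all)
qed

text \<open>At each 0-cell d and each 1-cell f from r to d, the laws reduce to those of the functor
  K(f).\<close>

lemma is_functor_\<Psi>hat: "is_functor (F0 K r) Q (\<Psi>hat D K r)"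
proof -
  interpret Q: category Q by (rule category_qNat)
  interpret Kr: category "F0 K r" by (rule category_K[OF r])
  show ?thesis
  proof (unfold_locales, goal_cases)
    case 1 show ?case by (simp add: \<Psi>hat_def)
  next
    case 2 show ?case by (simp add: \<Psi>hat_def)
  next
    case (3 U) then show ?case by (simp add: \<Psi>hat_def qNat_simps quasi_natural_\<Psi>hat_obj)
  next
    case (4 t U V)
    then have "U \<in> Obj (F0 K r)" "V \<in> Obj (F0 K r)" using Kr.Dom_Obj Kr.Cod_Obj by (auto simp:
        in_Hom_iff)
    then show ?case
      using modification_\<Psi>hat_arr[OF 4] 4 by (auto simp: \<Psi>hat_def in_Hom_qNat) (auto simp:
          in_Hom_iff)
  next
    case (5 U)
    note i = Kr.Ide_Hom[OF 5]
    have i': "Ide (F0 K r) U \<in> Arr (F0 K r)" "Dom (F0 K r) (Ide (F0 K r) U) = U" "Cod (F0 K r)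
        (Ide (F0 K r) U) = U"
      using i by (auto simp: in_Hom_iff)
    have "\<Psi>hat_arr D K r (Ide (F0 K r) U) = Ide Q (\<Psi>hat_obj D K r U)"
    proof (rule modification_eqI[OF modification_\<Psi>hat_arr[OF i] modification_Ide[OF
        quasi_natural_\<Psi>hat_obj[OF 5]]])
      fix d assume d: "d \<in> Obj0 D"
      have *: "MCmp (Ide Q (\<Psi>hat_obj D K r U)) d
          = Ide (functor_cat (Hom2 D r d) (F0 K d)) (Q1 (\<Psi>hat_obj D K r U) d)"
        using d by (simp add: qNat_simps)
      show "MCmp (\<Psi>hat_arr D K r (Ide (F0 K r) U)) d = MCmp (Ide Q (\<Psi>hat_obj D K r U)) d"
        unfolding *
      proof (rule nat_trans_eqI[OF nat_trans_\<Psi>hat_arr[OF i d] nat_trans_Ide[OF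
          is_functor_\<Psi>hat_obj[OF 5 d]]])
        fix f assume f: "f \<in> Obj (Hom2 D r d)"
        show "Cmp (MCmp (\<Psi>hat_arr D K r (Ide (F0 K r) U)) d) f
            = Cmp (Ide (functor_cat (Hom2 D r d) (F0 K d)) (Q1 (\<Psi>hat_obj D K r U) d)) f"
          using f d is_functor.FA_Ide[OF is_functor_K[OF r d f] 5] by (simp add: functor_cat_simps)
      qed (use d i' in \<open>simp_all add: functor_cat_simps\<close>)
    qed (use i' in \<open>simp_all add: qNat_simps\<close>)
    then show ?case using 5 i' by (simp add: \<Psi>hat_def)
  next
    case (6 t U V t' W)
    note tt = Kr.Comp_Hom[OF 6]
    have A: "t \<in> Arr (F0 K r)" "t' \<in> Arr (F0 K r)" "t' \<cdot>\<^bsub>F0 K r\<^esub> t \<in> Arr (F0 K r)"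
      "Dom (F0 K r) (t' \<cdot>\<^bsub>F0 K r\<^esub> t) = U" "Cod (F0 K r) (t' \<cdot>\<^bsub>F0 K r\<^esub> t) = W"
      "Dom (F0 K r) t = U" "Cod (F0 K r) t = V" "Dom (F0 K r) t' = V" "Cod (F0 K r) t' = W"
      using 6 tt by (auto simp: in_Hom_iff)
    have "\<Psi>hat_arr D K r (t' \<cdot>\<^bsub>F0 K r\<^esub> t) = \<Psi>hat_arr D K r t' \<cdot>\<^bsub>Q\<^esub> \<Psi>hat_arr D K r t"
    proof (rule modification_eqI[OF modification_\<Psi>hat_arr[OF tt]
          modification_Comp[OF modification_\<Psi>hat_arr[OF 6(1)] modification_\<Psi>hat_arr[OF 6(2)]]])
      fix d assume d: "d \<in> Obj0 D"
      have *: "MCmp (\<Psi>hat_arr D K r t' \<cdot>\<^bsub>Q\<^esub> \<Psi>hat_arr D K r t) d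
          = MCmp (\<Psi>hat_arr D K r t') d \<cdot>\<^bsub>functor_cat (Hom2 D r d) (F0 K d)\<^esub> MCmp (\<Psi>hat_arr D K r
              t) d"
        using d by (simp add: qNat_simps)
      show "MCmp (\<Psi>hat_arr D K r (t' \<cdot>\<^bsub>F0 K r\<^esub> t)) d = MCmp (\<Psi>hat_arr D K r t' \<cdot>\<^bsub>Q\<^esub> \<Psi>hat_arr D K r
          t) d"
        unfolding *
      proof (rule nat_trans_eqI[OF nat_trans_\<Psi>hat_arr[OF tt d]
            nat_trans_Comp[OF nat_trans_\<Psi>hat_arr[OF 6(1) d] nat_trans_\<Psi>hat_arr[OF 6(2) d]]])
        fix f assume f: "f \<in> Obj (Hom2 D r d)"
        show "Cmp (MCmp (\<Psi>hat_arr D K r (t' \<cdot>\<^bsub>F0 K r\<^esub> t)) d) f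
            = Cmp (MCmp (\<Psi>hat_arr D K r t') d \<cdot>\<^bsub>functor_cat (Hom2 D r d) (F0 K d)\<^esub> MCmp (\<Psi>hat_arr
                D K r t) d) f"
          using f d is_functor.FA_Comp[OF is_functor_K[OF r d f] 6] by (simp add: functor_cat_simps)
      qed (use d A in \<open>simp_all add: functor_cat_simps\<close>)
    qed (use A in \<open>simp_all add: qNat_simps\<close>)
    then show ?case using A by (simp add: \<Psi>hat_def)
  qed
qed

section \<open>The unit\<close>

definition unit_modif ::
  "('c, 'o, ('o, 'm, 'o, 'm) fctr, ('o, 'm, 'o, 'm) ntr) qntr \<Rightarrow>
   ('c, 'o, ('o, 'm, 'o, 'm) fctr, ('o, 'm, 'o, 'm) ntr) modif" where
  "unit_modif \<sigma> =
     (let \<sigma>' = \<Psi>hat_obj D K r (FO (Q1 \<sigma> r) (One D r))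
      in \<lparr>MSrc = \<sigma>, MTrg = \<sigma>',
          MCmp = (\<lambda>d\<in>Obj0 D. \<lparr>Src = Q1 \<sigma> d, Trg = Q1 \<sigma>' d,
                    Cmp = (\<lambda>f\<in>Obj (Hom2 D r d). Cmp (Q2 \<sigma> (r, d, f)) (One D r))\<rparr>)\<rparr>)"

lemma unit_modif_simps [simp]:
  "MSrc (unit_modif \<sigma>) = \<sigma>"
  "MTrg (unit_modif \<sigma>) = \<Psi>hat_obj D K r (FO (Q1 \<sigma> r) (One D r))"
  "d \<in> Obj0 D \<Longrightarrow> Src (MCmp (unit_modif \<sigma>) d) = Q1 \<sigma> d"
  "d \<in> Obj0 D \<Longrightarrow> Trg (MCmp (unit_modif \<sigma>) d) = Q1 (\<Psi>hat_obj D K r (FO (Q1 \<sigma> r) (One D r))) d"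
  "d \<in> Obj0 D \<Longrightarrow> f \<in> Obj (Hom2 D r d) \<Longrightarrow> Cmp (MCmp (unit_modif \<sigma>) d) f = Cmp (Q2 \<sigma> (r, d, f)) (One D
      r)"
  by (simp_all add: unit_modif_def Let_def)

lemma Q1_One_Obj: "quasi_natural D Cat R K \<sigma> \<Longrightarrow> FO (Q1 \<sigma> r) (One D r) \<in> Obj (F0 K r)"
  by (rule is_functor.FO_Obj[OF quasi_natural_Q1[OF _ r] K.D.One_Obj[OF r]])

text \<open>The component of \<sigma>_f at the identity starts at \<sigma>_d(f id); the strict right
  unit law of \<open>D\<close> makes this \<sigma>_d(f). Without it the unit would not have the
  right source.\<close>

lemma Cmp_Q2_One_Hom:
  assumes "quasi_natural D Cat R K \<sigma>" "d \<in> Obj0 D" "f \<in> Obj (Hom2 D r d)"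
  shows "Cmp (Q2 \<sigma> (r, d, f)) (One D r)
    \<in> Hom (F0 K d) (FO (Q1 \<sigma> d) f) (FO (F1 K r d f) (FO (Q1 \<sigma> r) (One D r)))"
  using Cmp_Q2_Hom[OF assms(1) r assms(2,3) K.D.One_Obj[OF r]] K.D.Comp1_One_right[OF r
      assms(2,3)] by simp

text \<open>Compatibility with \<alpha>, evaluated at the identity of r; whiskering \<alpha> with
  that identity gives back \<alpha>.\<close>

lemma Cmp_Q2_One_natural:
  assumes "quasi_natural D Cat R K \<sigma>" "d \<in> Obj0 D" "\<alpha> \<in> Hom (Hom2 D r d) f f'"
  shows "Cmp (F2 K r d \<alpha>) (FO (Q1 \<sigma> r) (One D r)) \<cdot>\<^bsub>F0 K d\<^esub> Cmp (Q2 \<sigma> (r, d, f)) (One D r)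
    = Cmp (Q2 \<sigma> (r, d, f')) (One D r) \<cdot>\<^bsub>F0 K d\<^esub> FA (Q1 \<sigma> d) \<alpha>"
proof -
  have "\<alpha> \<in> Arr (Hom2 D r d)" using assms(3) by (simp add: in_Hom_iff)
  then show ?thesis
    using Cmp_Q2_natural[OF assms(1) r assms(2,3) K.D.One_Obj[OF r]] K.D.Comp2_One_right[OF r
        assms(2)] by simp
qed

lemma nat_trans_unit_modif:
  assumes s: "quasi_natural D Cat R K \<sigma>" and d: "d \<in> Obj0 D"
  shows "nat_trans (Hom2 D r d) (F0 K d) (MCmp (unit_modif \<sigma>) d)"
proof (intro nat_trans.intro, goal_cases)
  case 1 show ?case using quasi_natural_Q1[OF s d] d by simp
next
  case 2 show ?case using is_functor_\<Psi>hat_obj[OF Q1_One_Obj[OF s]] d by simp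
next
  case 3 show ?case
  proof (unfold_locales, goal_cases)
    case 1 show ?case using d by (simp add: unit_modif_def Let_def)
  next
    case (2 f) then show ?case using Cmp_Q2_One_Hom[OF s d 2] d by simp
  next
    case (3 \<alpha> f f')
    then have "\<alpha> \<in> Arr (Hom2 D r d)" by (simp add: in_Hom_iff)
    then show ?case using Cmp_Q2_One_natural[OF s d 3] K.D.Dom_Cod_Hom2[OF r d 3] d by simp
  qed
qed

lemma modification_unit_modif:
  assumes s: "quasi_natural D Cat R K \<sigma>"
  shows "modification D Cat R K (unit_modif \<sigma>)"
proof -
  note U = Q1_One_Obj[OF s]
  show ?thesis
  proof (intro modification.intro, goal_cases)
    case 3 show ?case
    proof (intro modification_axioms.intro, goal_cases)
      case 1 show ?case by (simp add: unit_modif_def Let_def)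
    next
      case (2 a) then show ?case using nat_trans_unit_modif[OF s] by (simp add: in_Hom_functor_cat)
    next
      case (3 a b \<alpha> f f')
      let ?U = "FO (Q1 \<sigma> r) (One D r)"
      let ?\<tau> = "\<Psi>hat_obj D K r ?U" and ?\<Sigma> = "unit_modif \<sigma>"
      let ?A = "Hom2 D r a" and ?F = "functor_cat (Hom2 D r a) (F0 K b)"
      note ff' = K.D.Dom_Cod_Hom2[OF 3]
      interpret AB: category ?F by (rule category_functor_cat[OF category_K[OF 3(2)]])
      interpret Kb: category "F0 K b" by (rule category_K[OF 3(2)])
      have al: "\<alpha> \<in> Arr (Hom2 D a b)" "Dom (Hom2 D a b) \<alpha> = f" "Cod (Hom2 D a b) \<alpha> = f'"
        using 3(3) by (auto simp: in_Hom_iff)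
      note Ral = K.D.nat_trans_representable[OF r 3(1,2) al(1)]
      note Rst = K.D.representable_Src_Trg[OF 3(1,2) al(1), of r, unfolded al]
      note Kst = nat_trans_K(2,3)[OF 3]
      note s2 = quasi_natural_Q2[OF s 3(1,2) ff'(1)]
      let ?l = "hcomp ?A (F0 K b) (MCmp ?\<Sigma> b) (F2 R a b \<alpha>)"
      let ?r = "hcomp ?A (F0 K b) (F2 K a b \<alpha>) (MCmp ?\<Sigma> a)"
      have nl: "nat_trans ?A (F0 K b) ?l"
        by (rule nat_trans_hcomp[OF Ral nat_trans_unit_modif[OF s 3(2)]])
      have nr: "nat_trans ?A (F0 K b) ?r"
        by (rule nat_trans_hcomp[OF nat_trans_unit_modif[OF s 3(1)] nat_trans_K(1)[OF 3]])
      have nr': "nat_trans ?A (F0 K b) (?r \<cdot>\<^bsub>?F\<^esub> Q2 \<sigma> (a, b, f))"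
        by (rule nat_trans_Comp[OF s2(1) nr]) (use s2 Kst 3 in simp)
      \<comment> \<open>The target of the unit has identity 2-cells, so nothing but
        \<open>?l\<close> is left on one side of the axiom, while the 2-cell of \<sigma> at f
        survives on the other.\<close>
      have lr: "?l = ?r \<cdot>\<^bsub>?F\<^esub> Q2 \<sigma> (a, b, f)"
      proof (rule nat_trans_eqI[OF nl nr'])
        show "Src ?l = Src (?r \<cdot>\<^bsub>?F\<^esub> Q2 \<sigma> (a, b, f))" "Trg ?l = Trg (?r \<cdot>\<^bsub>?F\<^esub> Q2 \<sigma> (a, b, f))"
          using \<Psi>hat_obj_strict[OF U 3(1,2)] ff' Kst Rst s2 3 by (simp_all add: functor_cat_simps)
        fix g assume g: "g \<in> Obj ?A"
        note ag = K.D.Comp2_Hom[OF r 3(1,2) K.D.Ide_Hom2[OF r 3(1) g] 3(3)]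
        have fg: "Comp1 D r a b f g \<in> Obj (Hom2 D r b)" "Comp1 D r a b f' g \<in> Obj (Hom2 D r b)"
          using K.D.Dom_Cod_Hom2[OF r 3(2) ag] by auto
        have g1: "Comp1 D r r a g (One D r) = g" by (rule K.D.Comp1_One_right[OF r 3(1) g])
        let ?g = "Cmp (Q2 \<sigma> (r, a, g)) (One D r)"
        note h = Cmp_Q2_Hom[OF s 3(1,2) ff'(1) g]
          is_functor.FA_Hom[OF is_functor_K[OF 3(1,2) ff'(1)] Cmp_Q2_One_Hom[OF s 3(1) g]]
          nat_trans.Cmp_Hom[OF nat_trans_K(1)[OF 3] is_functor.FO_Obj[OF is_functor_K[OF r 3(1) g]
              U], unfolded Kst]
        have "Cmp ?l g = Cmp (Q2 \<sigma> (r, b, Comp1 D r a b f' g)) (One D r) \<cdot>\<^bsub>F0 K b\<^esub>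
            FA (Q1 \<sigma> b) (Comp2 D r a b \<alpha> (Ide ?A g))"
          using g al Rst ff' 3(1,2) fg by simp
        \<comment> \<open>Naturality of the unit in its 1-cell is used for the whiskered 2-cell from
          f g to f' g.\<close>
        also have "\<dots> = Cmp (F2 K r b (Comp2 D r a b \<alpha> (Ide ?A g))) ?U \<cdot>\<^bsub>F0 K b\<^esub>
            Cmp (Q2 \<sigma> (r, b, Comp1 D r a b f g)) (One D r)"
          by (rule Cmp_Q2_One_natural[OF s 3(2) ag, symmetric])
        \<comment> \<open>The left factor is rewritten by \<open>K_whisker_right\<close>; the right
          factor splits by the pasting law for f g, where \<open>g1\<close> identifies g after the
          identity with g.\<close>
        also have "\<dots> = Cmp (F2 K a b \<alpha>) (FO (F1 K r a g) ?U) \<cdot>\<^bsub>F0 K b\<^esub>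
            (FA (F1 K a b f) ?g \<cdot>\<^bsub>F0 K b\<^esub> Cmp (Q2 \<sigma> (a, b, f)) g)"
          using K_whisker_right[OF r 3(1,2) g 3(3) U]
            Cmp_Q2_Comp1[OF s r 3(1,2) g ff'(1) K.D.One_Obj[OF r]] g1 by simp
        also have "\<dots> = (Cmp (F2 K a b \<alpha>) (FO (F1 K r a g) ?U) \<cdot>\<^bsub>F0 K b\<^esub>
            FA (F1 K a b f) ?g) \<cdot>\<^bsub>F0 K b\<^esub> Cmp (Q2 \<sigma> (a, b, f)) g"
          by (rule Kb.Comp_assoc[OF h, symmetric])
        also have "\<dots> = Cmp (?r \<cdot>\<^bsub>?F\<^esub> Q2 \<sigma> (a, b, f)) g"
          using g 3(1,2) Kst by (simp add: functor_cat_simps(6))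
        finally show "Cmp ?l g = Cmp (?r \<cdot>\<^bsub>?F\<^esub> Q2 \<sigma> (a, b, f)) g" .
      qed
      have "?l \<in> Hom ?F (comp_functor ?A (Q1 \<sigma> b) (F1 R a b f)) (comp_functor ?A (Q1 ?\<tau> b) (F1 R a
          b f'))"
        using nl Rst 3(2) by (simp add: in_Hom_functor_cat)
      then show ?case
        using lr AB.Comp_Ide_left by (simp add: \<Psi>hat_obj_Q2 ff' 3(1,2))
    qed
  qed (use s quasi_natural_\<Psi>hat_obj[OF U] in simp_all)
qed

definition unit_trans where
  "unit_trans = \<lparr>Src = id_functor Q, Trg = comp_functor Q (\<Psi>hat D K r) (\<Psi> D K r), Cmp = restrict
      unit_modif (Obj Q)\<rparr>"

lemma nat_trans_unit: "nat_trans Q Q unit_trans"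
proof (intro nat_trans.intro, goal_cases)
  case 1 show ?case by (simp add: unit_trans_def is_functor_id category_qNat)
next
  case 2 show ?case by (simp add: unit_trans_def is_functor_comp[OF is_functor_\<Psi> is_functor_\<Psi>hat])
next
  case 3 show ?case
  proof (unfold_locales, goal_cases)
    case 1 show ?case by (simp add: unit_trans_def)
  next
    case (2 \<sigma>)
    then have "quasi_natural D Cat R K \<sigma>" by (simp add: qNat_simps)
    then show ?case using 2 modification_unit_modif[of \<sigma>] Q1_One_Obj[of \<sigma>]
      by (simp add: unit_trans_def in_Hom_qNat \<Psi>_def \<Psi>hat_def)
  next
    case (3 \<Sigma> \<sigma> \<tau>)
    then have S: "modification D Cat R K \<Sigma>" "\<Sigma> \<in> Arr Q" "MSrc \<Sigma> = \<sigma>" "MTrg \<Sigma> = \<tau>"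
      by (auto simp: in_Hom_iff qNat_simps)
    then have st: "quasi_natural D Cat R K \<sigma>" "quasi_natural D Cat R K \<tau>" "\<sigma> \<in> Obj Q" "\<tau> \<in> Obj Q"
      using quasi_natural_MSrc_MTrg[OF S(1)] by (auto simp: qNat_simps)
    note One = K.D.One_Obj[OF r]
    \<comment> \<open>\<open>?t\<close> is the value of the evaluation functor at \<Sigma>, so
      \<open>\<Psi>hat_arr D K r ?t\<close> is the image of \<Sigma> under the composite functor in
      the naturality square.\<close>
    let ?t = "Cmp (MCmp \<Sigma> r) (One D r)"
    have t: "?t \<in> Hom (F0 K r) (FO (Q1 \<sigma> r) (One D r)) (FO (Q1 \<tau> r) (One D r))"
      using Cmp_MCmp_Hom[OF S(1) r One] S by simp
    then have t': "?t \<in> Arr (F0 K r)" "Dom (F0 K r) ?t = FO (Q1 \<sigma> r) (One D r)"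
      "Cod (F0 K r) ?t = FO (Q1 \<tau> r) (One D r)" by (auto simp: in_Hom_iff)
    have "unit_modif \<tau> \<cdot>\<^bsub>Q\<^esub> \<Sigma> = \<Psi>hat_arr D K r ?t \<cdot>\<^bsub>Q\<^esub> unit_modif \<sigma>"
    proof (rule modification_eqI[OF modification_Comp[OF S(1) modification_unit_modif[OF st(2)]]
          modification_Comp[OF modification_unit_modif[OF st(1)] modification_\<Psi>hat_arr[OF t]]])
      fix d assume d: "d \<in> Obj0 D"
      let ?F = "functor_cat (Hom2 D r d) (F0 K d)"
      have *: "MCmp (unit_modif \<tau> \<cdot>\<^bsub>Q\<^esub> \<Sigma>) d = MCmp (unit_modif \<tau>) d \<cdot>\<^bsub>?F\<^esub> MCmp \<Sigma> d"
        "MCmp (\<Psi>hat_arr D K r ?t \<cdot>\<^bsub>Q\<^esub> unit_modif \<sigma>) d = MCmp (\<Psi>hat_arr D K r ?t) d \<cdot>\<^bsub>?F\<^esub> MCmp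
            (unit_modif \<sigma>) d"
        using d by (simp_all add: qNat_simps)
      note m = modification_MCmp[OF S(1) d]
      show "MCmp (unit_modif \<tau> \<cdot>\<^bsub>Q\<^esub> \<Sigma>) d = MCmp (\<Psi>hat_arr D K r ?t \<cdot>\<^bsub>Q\<^esub> unit_modif \<sigma>) d"
        unfolding *
      proof (rule nat_trans_eqI[OF nat_trans_Comp[OF m(1) nat_trans_unit_modif[OF st(2) d]]
            nat_trans_Comp[OF nat_trans_unit_modif[OF st(1) d] nat_trans_\<Psi>hat_arr[OF t d]]])
        fix f assume f: "f \<in> Obj (Hom2 D r d)"
        show "Cmp (MCmp (unit_modif \<tau>) d \<cdot>\<^bsub>?F\<^esub> MCmp \<Sigma> d) f
            = Cmp (MCmp (\<Psi>hat_arr D K r ?t) d \<cdot>\<^bsub>?F\<^esub> MCmp (unit_modif \<sigma>) d) f"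
          \<comment> \<open>At f the square reads \<tau>_f(id) after \<Sigma>_d(f) equals
            K(f)(\<Sigma>_r(id)) after \<sigma>_f(id): the modification axiom evaluated at the
            identity of r, with f id simplified to f.\<close>
          using Cmp_MCmp_natural[OF S(1) r d f One] K.D.Comp1_One_right[OF r d f] S f d
          by (simp add: functor_cat_simps(6))
      qed (use d S m t' in \<open>simp_all add: functor_cat_simps\<close>)
    qed (use S t' in \<open>simp_all add: qNat_simps\<close>)
    then show ?case
      using S st t' by (simp add: unit_trans_def \<Psi>_def \<Psi>hat_def)
  qed
qed

section \<open>The counit and the triangle identities\<close>

lemma \<Psi>_\<Psi>hat: "comp_functor (F0 K r) (\<Psi> D K r) (\<Psi>hat D K r) = id_functor (F0 K r)"
proof (rule is_functor_eqI[OF is_functor_comp[OF is_functor_\<Psi>hat is_functor_\<Psi>] is_functor_id[OF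
    category_K[OF r]]])
  note One = K.D.One_Obj[OF r]
  \<comment> \<open>Evaluating at the identity yields K(id)(U), and \<open>K_One\<close> makes this
    U itself; arrows are treated alike. The resulting equality of functors gives the identity
    transformation the source required of the counit.\<close>
  fix U assume "U \<in> Obj (F0 K r)"
  then show "FO (comp_functor (F0 K r) (\<Psi> D K r) (\<Psi>hat D K r)) U = FO (id_functor (F0 K r)) U"
    using One r K_One[OF r] quasi_natural_\<Psi>hat_obj by (simp add: \<Psi>_def \<Psi>hat_def qNat_simps)
next
  note One = K.D.One_Obj[OF r]
  fix t assume "t \<in> Arr (F0 K r)"
  then show "FA (comp_functor (F0 K r) (\<Psi> D K r) (\<Psi>hat D K r)) t = FA (id_functor (F0 K r)) t"
    using One r K_One[OF r] modification_\<Psi>hat_arr[OF Arr_in_Hom] by (simp add: \<Psi>_def \<Psi>hat_def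
        qNat_simps)
qed simp_all

lemma unit_modif_\<Psi>hat_obj:
  assumes U: "U \<in> Obj (F0 K r)"
  shows "unit_modif (\<Psi>hat_obj D K r U) = Ide Q (\<Psi>hat_obj D K r U)"
proof -
  let ?\<sigma> = "\<Psi>hat_obj D K r U"
  note s = quasi_natural_\<Psi>hat_obj[OF U] and One = K.D.One_Obj[OF r]
  \<comment> \<open>Recovering U exactly shows that the unit at this transformation has equal source
    and target, as comparison with an identity modification requires.\<close>
  have U': "FO (Q1 ?\<sigma> r) (One D r) = U" using U One r K_One[OF r] by simp
  show ?thesis
  proof (rule modification_eqI[OF modification_unit_modif[OF s] modification_Ide[OF s]])
    fix d assume d: "d \<in> Obj0 D"
    have *: "MCmp (Ide Q ?\<sigma>) d = Ide (functor_cat (Hom2 D r d) (F0 K d)) (Q1 ?\<sigma> d)"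
      using d by (simp add: qNat_simps)
    show "MCmp (unit_modif ?\<sigma>) d = MCmp (Ide Q ?\<sigma>) d"
      unfolding *
    proof (rule nat_trans_eqI[OF nat_trans_unit_modif[OF s d] nat_trans_Ide[OF
        is_functor_\<Psi>hat_obj[OF U d]]])
      fix f assume f: "f \<in> Obj (Hom2 D r d)"
      then show "Cmp (MCmp (unit_modif ?\<sigma>) d) f = Cmp (Ide (functor_cat (Hom2 D r d) (F0 K d)) (Q1
          ?\<sigma> d)) f"
        using d One r K.D.Comp1_One_right[OF r d f] by (simp add: \<Psi>hat_obj_Q2 functor_cat_simps)
    qed (use d U' in \<open>simp_all add: functor_cat_simps\<close>)
  qed (use U' in \<open>simp_all add: qNat_simps\<close>)
qed

lemma adjunction_\<Psi>_\<Psi>hat: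
  "adjunction Q (F0 K r) (\<Psi> D K r) (\<Psi>hat D K r) unit_trans
    (Ide (functor_cat (F0 K r) (F0 K r)) (id_functor (F0 K r)))"
proof -
  interpret Q: category Q by (rule category_qNat)
  interpret Kr: category "F0 K r" by (rule category_K[OF r])
  note One = K.D.One_Obj[OF r]
  show ?thesis
  proof (intro adjunction.intro is_functor_\<Psi> is_functor_\<Psi>hat nat_trans_unit nat_trans_Ide
      is_functor_id
      Kr.category_axioms adjunction_axioms.intro, goal_cases)
    case 1 show ?case by (simp add: unit_trans_def)
  next
    case 2 show ?case by (simp add: unit_trans_def)
  next
    case 3 show ?case by (simp add: functor_cat_simps \<Psi>_\<Psi>hat)
  next
    case 4 show ?case by (simp add: functor_cat_simps)
  next
    case (5 \<sigma>)
    then have s: "quasi_natural D Cat R K \<sigma>" by (simp add: qNat_simps)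
    \<comment> \<open>The component of the unit at the 0-cell r and the identity 1-cell is
      \<sigma>_id evaluated at the identity, which \<open>Cmp_Q2_One\<close> makes an identity arrow
      of K(r); composing it with the counit leaves an identity.\<close>
    show ?case
      using 5 One r Cmp_Q2_One[OF s r One] Q1_One_Obj[OF s] modification_unit_modif[OF s]
        Kr.Comp_Ide_left[OF Kr.Ide_Hom[OF Q1_One_Obj[OF s]]]
      by (simp add: \<Psi>_def unit_trans_def functor_cat_simps qNat_simps(2))
  next
    case (6 U)
    note s = quasi_natural_\<Psi>hat_obj[OF 6]
    \<comment> \<open>The counit contributes an identity, carried to an identity by functoriality,
      and \<open>unit_modif_\<Psi>hat_obj\<close> supplies the other factor; the triangle composes
      two identities.\<close>
    have "FA (\<Psi>hat D K r) (Ide (F0 K r) U) = Ide Q (\<Psi>hat_obj D K r U)"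
      using is_functor.FA_Ide[OF is_functor_\<Psi>hat 6] 6 by (simp add: \<Psi>hat_def)
    then show ?case
      using 6 s Q.Comp_Ide_left[OF Q.Ide_Hom] unit_modif_\<Psi>hat_obj[OF 6]
      by (simp add: \<Psi>hat_def unit_trans_def functor_cat_simps(5) qNat_simps(1))
  qed
qed

end


theorem lemma1:
  fixes D :: "('c, 'o, 'm) two_cat"
    and K :: "('c, 'o, 'm, ('o, 'm) cat, ('o, 'm, 'o, 'm) fctr, ('o, 'm, 'o, 'm) ntr) two_fctr"
    and r :: 'c
  assumes "two_category D"
    and "two_functor D Cat K"
    and "r \<in> Obj0 D"
  shows "\<exists>\<eta> \<epsilon>.
      adjunction (qNat D Cat (representable D r) K) (F0 K r) (\<Psi> D K r) (\<Psi>hat D K r) \<eta> \<epsilon>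
    \<and> quasi_natural_trans (qNat D Cat (representable D r) K) (qNat D Cat (representable D r) K) \<eta>
    \<and> \<epsilon> = Ide (functor_cat (F0 K r) (F0 K r)) (id_functor (F0 K r))"
proof -
  interpret cat_valued D K r
    using assms by (intro cat_valued.intro cat_valued_axioms.intro)
  show ?thesis
    using adjunction_\<Psi>_\<Psi>hat quasi_natural_trans_nat_trans[OF nat_trans_unit] by blast
qed

end
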